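(* There exists a constant $C_2>0$ such that for every $\beta\ge1$ there is a constant $C>0$ for which the following holds. Let $N\ge512$, let $\Phi_1,\Phi_2$ be two orthonormal bases of $\mathbb{C}^N$ with mutual incoherence $\mu$ satisfying $\mu\le1/\sqrt{2(\beta+1)\log N}$, and let $\Phi=(\Phi_1\;\;\Phi_2)$. Let $p_1,p_2\in[0,1]$ be sampling parameters with $\min(\mathbf{E}|\Gamma_1|,\mathbf{E}|\Gamma_2|)\ge4(\beta+1)\log N$ and $$\mathbf{E}|\Gamma_1|+\mathbf{E}|\Gamma_2|\le\frac{C_2}{\mu^2\cdot((\beta+1)\log N)^{5/2}}.$$ Let $f=\Phi\alpha$, where the random support $\Gamma=\Gamma_1\cup\Gamma_2$ and the random coefficient vector $\alpha$ supported on $\Gamma$ are sampled according to the probability model. Then with probability at least $1-C\log N\cdot N^{-\beta}$, the solution to $$(P_0)\qquad\min_{\alpha'\in\mathbb{C}^{2N}}\|\alpha'\|_{\ell_0}\quad\text{subject to}\quad\Phi\alpha'=f$$ is unique and equal to $\alpha$.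
   Context: $\Phi=(\Phi_1\;\;\Phi_2)$ is the $N\times2N$ matrix whose first $N$ columns are the vectors of the orthonormal basis $\Phi_1$ and last $N$ columns those of $\Phi_2$. The mutual incoherence is $\mu=\mu(\Phi_1,\Phi_2)=\max_{\phi\in\Phi_1,\psi\in\Phi_2}|\langle\phi,\psi\rangle|$. $\|\alpha\|_{\ell_0}$ is the number of nonzero entries of $\alpha$. Probability model: $I_1(j)$ and $I_2(j)$, $j=0,\dots,N-1$, are two independent sequences of i.i.d. Bernoulli random variables with parameters $p_1$ and $p_2$ respectively; $\Gamma_1=\{j:I_1(j)=1\}$, $\Gamma_2=\{j:I_2(j)=1\}$, so $\mathbf{E}|\Gamma_i|=p_iN$. $\Gamma=\Gamma_1\cup\Gamma_2$ is viewed as a subset of the $2N$ column indices of $\Phi$ (disjoint union: $\Gamma_1$ among the columns of $\Phi_1$, $\Gamma_2$ among those of $\Phi_2$). Given $(\Gamma_1,\Gamma_2)$, the coefficients $\{\alpha(\gamma),\gamma\in\Gamma\}$ are i.i.d. draws from a continuous probability distribution on $\mathbb{C}$ (one having a density) that is circularly symmetric (phase uniform on $[0,2\pi)$), and $\alpha(\gamma)=0$ for $\gamma\notin\Gamma$. $\log$ is the natural logarithm. *)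

theory Defs
  imports "HOL-Probability.Probability" "Jordan_Normal_Form.VS_Connect"
begin

hide_const (open) Finite_Cartesian_Product.vec

definition orthonormal_basis :: "nat \<Rightarrow> complex Matrix.vec list \<Rightarrow> bool" where
  "orthonormal_basis N B \<longleftrightarrow>
     length B = N \<and>
     vectorspace.basis class_ring (module_vec TYPE(complex) N) (set B) \<and>
     (\<forall>i<N. \<forall>j<N. B ! i \<bullet>c B ! j = (if i = j then 1 else 0))"

definition mutual_incoherence :: "complex Matrix.vec list \<Rightarrow> complex Matrix.vec list \<Rightarrow> real" where
  "mutual_incoherence B1 B2 = Max ((\<lambda>(v, w). cmod (v \<bullet>c w)) ` (set B1 \<times> set B2))"

definition dictionary :: "nat \<Rightarrow> complex Matrix.vec list \<Rightarrow> complex Matrix.vec list \<Rightarrow> complex mat" where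
  "dictionary N B1 B2 = mat_of_cols N (B1 @ B2)"

definition l0_norm :: "complex Matrix.vec \<Rightarrow> nat" where
  "l0_norm a = card {i. i < dim_vec a \<and> a $ i \<noteq> 0}"

definition P0_solutions :: "complex mat \<Rightarrow> complex Matrix.vec \<Rightarrow> complex Matrix.vec set" where
  "P0_solutions A f =
     {a \<in> carrier_vec (dim_col A). A *\<^sub>v a = f \<and>
        (\<forall>b \<in> carrier_vec (dim_col A). A *\<^sub>v b = f \<longrightarrow> l0_norm a \<le> l0_norm b)}"

definition bernoulli_subset :: "nat \<Rightarrow> real \<Rightarrow> nat set pmf" where
  "bernoulli_subset N p =
     map_pmf (\<lambda>I. {j \<in> {..<N}. I j}) (Pi_pmf {..<N} False (\<lambda>_. bernoulli_pmf p))"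

definition expected_card :: "nat \<Rightarrow> real \<Rightarrow> real" where
  "expected_card N p = measure_pmf.expectation (bernoulli_subset N p) (\<lambda>S. real (card S))"

text \<open>The random support as a set of column indices of the dictionary: the columns
  \<open>N, \<dots>, 2 * N - 1\<close> are those of the second basis.\<close>

definition support_pmf :: "nat \<Rightarrow> real \<Rightarrow> real \<Rightarrow> nat set pmf" where
  "support_pmf N p1 p2 =
     map_pmf (\<lambda>(S1, S2). S1 \<union> (\<lambda>j. N + j) ` S2)
       (pair_pmf (bernoulli_subset N p1) (bernoulli_subset N p2))"

text \<open>The conditional law of the coefficients given the support \<open>S\<close>: independent entries,
  with law \<open>D\<close> on \<open>S\<close> and equal to 0 off \<open>S\<close>.\<close>

definition coeff_given_support ::
    "nat \<Rightarrow> complex measure \<Rightarrow> nat set \<Rightarrow> (nat \<Rightarrow> complex) measure" where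
  "coeff_given_support N D S =
     (\<Pi>\<^sub>M k\<in>{..<2 * N}. if k \<in> S then D else return borel 0)"

definition coeff_law ::
    "nat \<Rightarrow> real \<Rightarrow> real \<Rightarrow> complex measure \<Rightarrow> (nat \<Rightarrow> complex) measure" where
  "coeff_law N p1 p2 D =
     Giry_Monad.bind (measure_pmf (support_pmf N p1 p2)) (coeff_given_support N D)"

definition continuous_distribution :: "complex measure \<Rightarrow> bool" where
  "continuous_distribution D \<longleftrightarrow>
     prob_space D \<and> (\<exists>g. g \<in> borel_measurable lborel \<and> D = density lborel g)"

text \<open>Circular symmetry is invariance in law under all rotations about the origin; for a law
  without an atom at 0 this says that the phase is uniform and independent of the modulus.\<close>

definition circularly_symmetric :: "complex measure \<Rightarrow> bool" where
  "circularly_symmetric D \<longleftrightarrow> (\<forall>t::real. distr D borel (\<lambda>z. cis t * z) = D)"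

lemma
  assumes "continuous_distribution D"
  shows sets_coeff_given_support: "sets (coeff_given_support N D S) = sets (\<Pi>\<^sub>M k\<in>{..<2 * N}. borel)"
    and prob_space_coeff_given_support: "prob_space (coeff_given_support N D S)"
proof -
  have D: "prob_space D" "sets D = sets borel"
    using assms by (auto simp: continuous_distribution_def)
  show "sets (coeff_given_support N D S) = sets (\<Pi>\<^sub>M k\<in>{..<2 * N}. borel)"
    unfolding coeff_given_support_def by (rule sets_PiM_cong) (auto simp: D)
  show "prob_space (coeff_given_support N D S)"
    unfolding coeff_given_support_def
    by (rule prob_space_PiM) (auto simp: D intro: prob_space_return)
qed

lemma
  assumes "continuous_distribution D"
  shows sets_coeff_law: "sets (coeff_law N p1 p2 D) = sets (\<Pi>\<^sub>M k\<in>{..<2 * N}. borel)"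
    and emeasure_coeff_law: "A \<in> sets (\<Pi>\<^sub>M k\<in>{..<2 * N}. borel) \<Longrightarrow> emeasure (coeff_law N p1 p2 D) A =
      (\<integral>\<^sup>+S. emeasure (coeff_given_support N D S) A \<partial>measure_pmf (support_pmf N p1 p2))"
    and prob_space_coeff_law: "prob_space (coeff_law N p1 p2 D)"
proof -
  let ?K = "\<Pi>\<^sub>M k\<in>{..<2 * N}. (borel :: complex measure)"
  let ?P = "measure_pmf (support_pmf N p1 p2)"
  have m: "coeff_given_support N D \<in> measurable ?P (subprob_algebra ?K)"
    by (auto simp: space_subprob_algebra sets_coeff_given_support[OF assms]
        intro!: prob_space_imp_subprob_space prob_space_coeff_given_support[OF assms])
  show s: "sets (coeff_law N p1 p2 D) = sets ?K"
    unfolding coeff_law_def by (rule sets_bind) (auto simp: sets_coeff_given_support[OF assms])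
  show e: "emeasure (coeff_law N p1 p2 D) A = (\<integral>\<^sup>+S. emeasure (coeff_given_support N D S) A \<partial>?P)"
    if "A \<in> sets ?K" for A
    unfolding coeff_law_def using m that by (intro emeasure_bind) auto
  show "prob_space (coeff_law N p1 p2 D)"
    unfolding coeff_law_def
    by (rule measure_pmf.prob_space_bind[OF _ m])
       (simp add: prob_space_coeff_given_support[OF assms])
qed

lemma expected_card_eq:
  assumes "0 \<le> p" "p \<le> 1"
  shows "expected_card N p = p * real N"
proof -
  let ?Q = "Pi_pmf {..<N} False (\<lambda>_. bernoulli_pmf p)"
  have fin: "finite (set_pmf ?Q)"
    by (simp add: set_Pi_pmf finite_PiE_dflt)
  have c: "real (card {j \<in> {..<N}. I j}) = (\<Sum>j<N. of_bool (I j))" for I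
    by (simp add: of_bool_def sum.If_cases Int_def)
  have "expected_card N p = measure_pmf.expectation ?Q (\<lambda>I. \<Sum>j<N. of_bool (I j))"
    unfolding expected_card_def bernoulli_subset_def integral_map_pmf c ..
  also have "\<dots> = (\<Sum>j<N. measure_pmf.expectation ?Q (\<lambda>I. of_bool (I j)))"
    by (rule Bochner_Integration.integral_sum) (auto intro: integrable_measure_pmf_finite fin)
  also have "\<dots> = (\<Sum>j<N. measure_pmf.expectation (map_pmf (\<lambda>I. I j) ?Q) of_bool)"
    by simp
  also have "\<dots> = (\<Sum>j<N. p)"
    by (rule sum.cong) (use assms in \<open>simp_all add: Pi_pmf_component del: integral_map_pmf\<close>)
  finally show ?thesis by simp
qed

end

theory Submission
  imports Defs
begin

text \<open>
  Call a support \<open>S\<close> of columns of the dictionary \<^emph>\<open>extendable\<close> if \<open>S\<close> together with any one further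
  column is linearly independent. Two facts carry the theorem.

  \<^emph>\<open>An extendable support is recovered almost surely.\<close> Let \<open>T \<noteq> S\<close> have at most \<open>card S\<close> elements. If
  the columns in \<open>S\<close> all lay in the span of those in \<open>T\<close>, that span would contain too many independent
  vectors: the columns in \<open>S\<close> and, unless \<open>T \<subseteq> S\<close>, also a column of \<open>T\<close> outside \<open>S\<close>. Hence some column \<open>g \<in> S\<close>
  is not in the span of \<open>T\<close> (\<open>ex_col_not_in_span\<close>), and if all coefficients but that of \<open>g\<close> are
  fixed, at most one value of the last one puts \<open>\<Phi> \<alpha>\<close> into the span. A law with a density gives that value
  probability zero (\<open>AE_not_in_col_span\<close>). There are finitely many \<open>T\<close>, so almost surely no other
  support of size at most \<open>card S\<close> represents \<open>\<Phi> \<alpha>\<close>.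

  \<^emph>\<open>A random support is extendable with high probability.\<close> Let \<open>U\<close> be the unitary matrix of inner
  products between the two bases, \<open>H\<close> a fixed set of columns of one basis and \<open>G\<close> a random set of
  columns of the other. A linear relation between the columns in \<open>G\<close> and \<open>H\<close> yields a nonzero vector
  supported in \<open>G\<close> and fixed by the projection \<open>P i k = (\<Sum>j\<in>H. U i j * cnj (U k j))\<close>, and such a
  vector forces the trace of \<open>P (1\<^sub>G P)\<^sup>n\<close> to be at least 1, for even \<open>n\<close>
  (\<open>fixed_vector_imp_trace_ge_1\<close>). The expected trace \<open>\<tau>\<^sub>n\<close> is small: opening the trace at
  the index \<open>i\<close> of one of the factors \<open>1\<^sub>G\<close> and removing \<open>i\<close> from the other factors costs, by a rank-one
  expansion and log-convexity in \<open>n\<close>, only a term of relative size \<open>n R\<close>, where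
  \<open>R = card H * \<mu>\<^sup>2\<close> bounds the diagonal of \<open>P\<close>. The index \<open>i\<close> is then independent of what remains, and
  \<open>\<tau>\<^sub>n\<^sub>+\<^sub>1 \<le> (p + n R) \<tau>\<^sub>n\<close> (\<open>mean_trace_Suc_le\<close>). With \<open>n\<close> about \<open>2 L\<close>,
  where \<open>L = (\<beta> + 1) ln N\<close>, the sparsity assumption makes \<open>p + n R\<close> at most \<open>exp (- 2)\<close>, so that the
  probability of a relation is at most \<open>N exp (- 4 L)\<close>; this survives a union bound over the
  additional column. The size of \<open>H\<close> is controlled by a Chernoff bound
  (\<open>prob_extended_dependent_pair_le\<close>).

  The uniqueness event is a finite Boolean combination of statements that a vector depending linearly on
  the coefficients lies in a fixed subspace (\<open>P0_solutions_eq_iff\<close>). This gives both its measurability and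
  its probability given the support.
\<close>

section \<open>Walk sums of a projection kernel\<close>

text \<open>The ratios \<open>b (n + 1) / b n\<close> of a log-convex sequence increase. If some term vanishes, log-convexity
  spreads the zero to every term except possibly \<open>b 0\<close>.\<close>

lemma log_convex_mult_le:
  fixes b :: "nat \<Rightarrow> real"
  assumes nonneg: "\<And>n. 0 \<le> b n" and conv: "\<And>n. (b (Suc n))\<^sup>2 \<le> b n * b (Suc (Suc n))"
  shows "b j * b l \<le> b 0 * b (j + l)"
proof (cases "\<exists>n. b n = 0")
  case True
  have up: "b (Suc n) = 0" if "b n = 0" for n
    using conv[of n] that by simp
  have down: "b (Suc n) = 0" if "b (Suc (Suc n)) = 0" for n
    using conv[of n] that by simp
  from True obtain n where n: "b n = 0" by blast
  have "b (Suc n) = 0" using up n by blast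
  then have b1: "b 1 = 0"
    by (induction n) (auto dest: down)
  have "b (Suc m) = 0" for m
    by (induction m) (use b1 up in auto)
  then show ?thesis
    by (cases j; cases l) (auto simp: nonneg)
next
  case False
  then have pos: "b n > 0" for n
    using nonneg[of n] by (metis less_eq_real_def)
  \<comment> \<open>The ratios of consecutive terms increase.\<close>
  have mono: "b (Suc n) / b n \<le> b (Suc (n + m)) / b (n + m)" for n m
  proof (induction m)
    case (Suc m)
    have "b (Suc (n + m)) / b (n + m) \<le> b (Suc (Suc (n + m))) / b (Suc (n + m))"
      using conv[of "n + m"] pos by (simp add: field_simps power2_eq_square)
    with Suc show ?case by simp
  qed simp
  have "b j * b l \<le> b 0 * b (j + l)"
  proof (induction j)
    case (Suc j)
    have "b (Suc j) * b l = (b (Suc j) / b j) * (b j * b l)"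
      using pos[of j] by simp
    also have "\<dots> \<le> (b (Suc (j + l)) / b (j + l)) * (b 0 * b (j + l))"
      by (intro mult_mono mono Suc) (auto intro!: mult_nonneg_nonneg divide_nonneg_nonneg nonneg)
    also have "\<dots> = b 0 * b (Suc j + l)"
      using pos[of "j + l"] by simp
    finally show ?case .
  qed simp
  then show ?thesis .
qed

lemma norm_sum_mult_le:
  fixes a b :: "'a \<Rightarrow> complex"
  shows "(cmod (\<Sum>i\<in>A. a i * b i))\<^sup>2 \<le> (\<Sum>i\<in>A. (cmod (a i))\<^sup>2) * (\<Sum>i\<in>A. (cmod (b i))\<^sup>2)"
proof -
  have "cmod (\<Sum>i\<in>A. a i * b i) \<le> (\<Sum>i\<in>A. cmod (a i) * cmod (b i))"
    by (rule order_trans[OF norm_sum]) (simp add: norm_mult)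
  then have "(cmod (\<Sum>i\<in>A. a i * b i))\<^sup>2 \<le> (\<Sum>i\<in>A. cmod (a i) * cmod (b i))\<^sup>2"
    by (intro power_mono) auto
  also have "\<dots> \<le> (\<Sum>i\<in>A. (cmod (a i))\<^sup>2) * (\<Sum>i\<in>A. (cmod (b i))\<^sup>2)"
    by (rule Cauchy_Schwarz_ineq_sum)
  finally show ?thesis .
qed

text \<open>In matrix terms this is the entry at \<open>(i, j)\<close> of \<open>P (1\<^sub>G P)\<^sup>n\<close>, with \<open>1\<^sub>G\<close> the diagonal indicator
  matrix of \<open>G\<close>. If \<open>P\<close> is the Gram matrix of vectors \<open>v i\<close> and \<open>S\<close> the sum over \<open>k \<in> G\<close> of the rank-one
  operators on \<open>v k\<close>, it is the matrix coefficient of \<open>S ^ n\<close> between \<open>v i\<close> and \<open>v j\<close>.\<close>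

fun walk :: "('a \<Rightarrow> 'a \<Rightarrow> complex) \<Rightarrow> 'a set \<Rightarrow> nat \<Rightarrow> 'a \<Rightarrow> 'a \<Rightarrow> complex" where
  "walk P G 0 i j = P i j"
| "walk P G (Suc n) i j = (\<Sum>k\<in>G. P i k * walk P G n k j)"

definition walk_diag :: "('a \<Rightarrow> 'a \<Rightarrow> complex) \<Rightarrow> 'a set \<Rightarrow> nat \<Rightarrow> 'a \<Rightarrow> real" where
  "walk_diag P G n i = Re (walk P G n i i)"

lemma walk_split:
  "walk P G (Suc (m + n)) i j = (\<Sum>k\<in>G. walk P G m i k * walk P G n k j)"
proof (induction m arbitrary: i)
  case (Suc m)
  have "walk P G (Suc (Suc m + n)) i j = (\<Sum>k\<in>G. P i k * (\<Sum>l\<in>G. walk P G m k l * walk P G n l j))"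
    using Suc by simp
  also have "\<dots> = (\<Sum>l\<in>G. \<Sum>k\<in>G. P i k * walk P G m k l * walk P G n l j)"
    unfolding sum_distrib_left by (subst sum.swap) (simp add: mult.assoc)
  finally show ?case by (simp add: sum_distrib_right)
qed simp

text \<open>Split a walk through \<open>insert i G\<close> at its first visit to \<open>i\<close>.\<close>

lemma walk_insert:
  assumes "finite G" "i \<notin> G"
  shows "walk P (insert i G) n k l =
    walk P G n k l + (\<Sum>j<n. walk P G j k i * walk P (insert i G) (n - Suc j) i l)"
proof (induction n arbitrary: k)
  case (Suc n)
  let ?W = "walk P (insert i G)"
  have "?W (Suc n) k l = P k i * ?W n i l + (\<Sum>h\<in>G. P k h * ?W n h l)"
    using assms by simp
  also have "(\<Sum>h\<in>G. P k h * ?W n h l) =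
      (\<Sum>h\<in>G. P k h * walk P G n h l) + (\<Sum>h\<in>G. \<Sum>j<n. P k h * (walk P G j h i * ?W (n - Suc j) i l))"
    by (subst Suc) (simp add: distrib_left sum.distrib sum_distrib_left)
  also have "(\<Sum>h\<in>G. \<Sum>j<n. P k h * (walk P G j h i * ?W (n - Suc j) i l)) =
      (\<Sum>j<n. walk P G (Suc j) k i * ?W (n - Suc j) i l)"
    by (subst sum.swap) (simp add: sum_distrib_right mult.assoc)
  finally show ?case
    by (subst sum.lessThan_Suc_shift) simp
qed simp

text \<open>Idempotence provides a second way of cutting a walk, at an index of all of \<open>A\<close>
  (\<open>walk_join\<close>), besides cutting it at one of its steps in \<open>G\<close> (\<open>walk_split\<close>). Together the two cuts
  reach walks of both parities, which is how positivity and log-convexity below are obtained.\<close>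

locale projection_kernel =
  fixes A :: "'a set" and P :: "'a \<Rightarrow> 'a \<Rightarrow> complex"
  assumes finite_A: "finite A"
    and herm: "\<And>i j. P j i = cnj (P i j)"
    and idem: "\<And>i j. i \<in> A \<Longrightarrow> j \<in> A \<Longrightarrow> (\<Sum>k\<in>A. P i k * P k j) = P i j"
begin

lemma walk_herm: "walk P G n j i = cnj (walk P G n i j)"
proof (induction n arbitrary: i j)
  case (Suc n)
  have "walk P G (Suc n) j i = (\<Sum>k\<in>G. P j k * walk P G n k i)"
    by simp
  also have "\<dots> = (\<Sum>k\<in>G. cnj (P k j) * cnj (walk P G n i k))"
    by (intro sum.cong refl arg_cong2[where f = "(*)"] herm Suc)
  also have "\<dots> = cnj (\<Sum>k\<in>G. walk P G n i k * walk P G 0 k j)"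
    by (simp add: mult.commute)
  also have "\<dots> = cnj (walk P G (Suc n) i j)"
    by (subst walk_split[symmetric]) simp
  finally show ?case .
qed (simp, rule herm)

lemma walk_join:
  assumes "G \<subseteq> A" "i \<in> A" "j \<in> A"
  shows "(\<Sum>k\<in>A. walk P G m i k * walk P G n k j) = walk P G (m + n) i j"
  using assms(2)
proof (induction m arbitrary: i)
  case 0
  show ?case
  proof (cases n)
    case 0
    then show ?thesis using idem \<open>i \<in> A\<close> \<open>j \<in> A\<close> by simp
  next
    case (Suc n')
    have "(\<Sum>k\<in>A. P i k * (\<Sum>l\<in>G. P k l * walk P G n' l j)) =
        (\<Sum>l\<in>G. (\<Sum>k\<in>A. P i k * P k l) * walk P G n' l j)"
      unfolding sum_distrib_left sum_distrib_right by (subst sum.swap) (simp add: mult.assoc)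
    also have "\<dots> = (\<Sum>l\<in>G. P i l * walk P G n' l j)"
      using idem assms 0 by (intro sum.cong) auto
    finally show ?thesis using Suc by simp
  qed
next
  case (Suc m)
  have "(\<Sum>k\<in>A. walk P G (Suc m) i k * walk P G n k j) =
      (\<Sum>l\<in>G. P i l * (\<Sum>k\<in>A. walk P G m l k * walk P G n k j))"
    unfolding walk.simps sum_distrib_left sum_distrib_right
    by (subst sum.swap) (simp add: mult.assoc)
  also have "\<dots> = (\<Sum>l\<in>G. P i l * walk P G (m + n) l j)"
    using Suc assms by (intro sum.cong) auto
  finally show ?case by simp
qed

lemma walk_diag_complex: "walk P G n i i = of_real (walk_diag P G n i)"
proof -
  have "walk P G n i i \<in> \<real>"
    unfolding Reals_cnj_iff by (rule walk_herm[symmetric])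
  then show ?thesis
    unfolding walk_diag_def by (rule of_real_Re[symmetric])
qed

lemma walk_mult_herm: "walk P G n i l * walk P G n l i = of_real ((cmod (walk P G n i l))\<^sup>2)"
  unfolding complex_norm_square walk_herm[of G n l i, symmetric] ..

lemma walk_diag_even:
  assumes "G \<subseteq> A" "i \<in> A"
  shows "walk_diag P G (2 * k) i = (\<Sum>l\<in>A. (cmod (walk P G k i l))\<^sup>2)"
proof -
  have "walk P G (2 * k) i i = of_real (\<Sum>l\<in>A. (cmod (walk P G k i l))\<^sup>2)"
    unfolding mult_2 walk_join[OF assms assms(2), symmetric] walk_mult_herm of_real_sum ..
  then show ?thesis by (simp only: walk_diag_def Re_complex_of_real)
qed

lemma walk_diag_odd:
  "walk_diag P G (Suc (2 * k)) i = (\<Sum>l\<in>G. (cmod (walk P G k i l))\<^sup>2)"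
proof -
  have "walk P G (Suc (2 * k)) i i = of_real (\<Sum>l\<in>G. (cmod (walk P G k i l))\<^sup>2)"
    unfolding mult_2 walk_split walk_mult_herm of_real_sum ..
  then show ?thesis by (simp only: walk_diag_def Re_complex_of_real)
qed

lemma walk_diag_nonneg:
  assumes "G \<subseteq> A" "i \<in> A"
  shows "0 \<le> walk_diag P G n i"
proof (cases "even n")
  case True
  then obtain k where "n = 2 * k" by blast
  then show ?thesis using walk_diag_even[OF assms] by (simp add: sum_nonneg)
next
  case False
  then obtain k where "n = Suc (2 * k)" by (auto elim: oddE)
  then show ?thesis using walk_diag_odd by (simp add: sum_nonneg)
qed

lemma walk_diag_square:
  "(walk_diag P G n i)\<^sup>2 = (cmod (walk P G n i i))\<^sup>2"
  unfolding walk_diag_complex by simp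

text \<open>Cut a closed walk of length \<open>n + 1\<close> into pieces of lengths as equal as possible and apply the
  Cauchy-Schwarz inequality at the cut; the two squared norms are closed walks of lengths \<open>n\<close> and \<open>n + 2\<close>.\<close>

lemma walk_diag_log_convex:
  assumes "G \<subseteq> A" "i \<in> A"
  shows "(walk_diag P G (Suc n) i)\<^sup>2 \<le> walk_diag P G n i * walk_diag P G (Suc (Suc n)) i"
proof -
  have sym: "(\<Sum>l\<in>B. (cmod (walk P G m l i))\<^sup>2) = (\<Sum>l\<in>B. (cmod (walk P G m i l))\<^sup>2)" for m B
    by (intro sum.cong refl) (subst walk_herm, simp)
  show ?thesis
  proof (cases "even n")
    case True
    then obtain k where n: "n = 2 * k" by blast
    have eq: "walk P G (Suc (2 * k)) i i = (\<Sum>l\<in>A. walk P G k i l * walk P G (Suc k) l i)"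
      by (subst walk_join[OF assms assms(2)]) (simp add: mult_2)
    have n2: "Suc (Suc (2 * k)) = 2 * Suc k" by simp
    show ?thesis
      unfolding n walk_diag_square eq n2 walk_diag_even[OF assms]
      by (subst sym[of "Suc k" A, symmetric]) (rule norm_sum_mult_le)
  next
    case False
    then obtain k where n: "n = Suc (2 * k)" by (auto elim: oddE)
    have eq: "walk P G (Suc (Suc (2 * k))) i i = (\<Sum>l\<in>G. walk P G k i l * walk P G (Suc k) l i)"
      by (subst walk_split[symmetric]) (simp add: mult_2)
    have n2: "Suc (Suc (Suc (2 * k))) = Suc (2 * Suc k)" by simp
    show ?thesis
      unfolding n walk_diag_square eq n2 walk_diag_odd
      by (subst sym[of "Suc k" G, symmetric]) (rule norm_sum_mult_le)
  qed
qed

lemma walk_diag_insert: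
  assumes "insert i G \<subseteq> A" "i \<notin> G"
  shows "walk_diag P (insert i G) n i = walk_diag P G n i +
    (\<Sum>j<n. walk_diag P G j i * walk_diag P (insert i G) (n - Suc j) i)"
proof -
  have "finite G" using assms finite_A finite_subset by auto
  from walk_insert[OF this assms(2), of P n i i] show ?thesis
    unfolding walk_diag_complex of_real_sum[symmetric] of_real_mult[symmetric]
      of_real_add[symmetric] of_real_eq_iff .
qed

lemma walk_diag_insert_mono:
  assumes "insert i G \<subseteq> A" "i \<notin> G"
  shows "walk_diag P G n i \<le> walk_diag P (insert i G) n i"
proof -
  have "0 \<le> (\<Sum>j<n. walk_diag P G j i * walk_diag P (insert i G) (n - Suc j) i)"
    using assms by (intro sum_nonneg mult_nonneg_nonneg walk_diag_nonneg) auto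
  then show ?thesis using walk_diag_insert[OF assms, of n] by linarith
qed

text \<open>The price of removing \<open>i\<close> from the index set. In the expansion at the first visit to \<open>i\<close>, each of the
  \<open>n\<close> correction terms is a product of two closed walks of total length \<open>n - 1\<close>, and log-convexity
  concentrates the whole length in one of them, leaving a factor \<open>P i i\<close>. For \<open>n = 0\<close> the truncated
  subtraction is harmless because the correction is multiplied by \<open>n\<close>.\<close>

lemma walk_diag_insert_le:
  assumes "insert i G \<subseteq> A" "i \<notin> G"
  shows "walk_diag P (insert i G) n i \<le> walk_diag P G n i +
    real n * Re (P i i) * walk_diag P (insert i G) (n - 1) i"
proof -
  let ?b = "\<lambda>n. walk_diag P (insert i G) n i"
  have i: "i \<in> A" using assms by simp
  note nn = walk_diag_nonneg[OF assms(1) i]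
  have "?b n = walk_diag P G n i + (\<Sum>j<n. walk_diag P G j i * ?b (n - Suc j))"
    by (rule walk_diag_insert[OF assms])
  also have "(\<Sum>j<n. walk_diag P G j i * ?b (n - Suc j)) \<le> (\<Sum>j<n. ?b 0 * ?b (n - 1))"
  proof (rule sum_mono)
    fix j assume j: "j \<in> {..<n}"
    have "walk_diag P G j i * ?b (n - Suc j) \<le> ?b j * ?b (n - Suc j)"
      by (intro mult_right_mono walk_diag_insert_mono assms nn)
    also have "\<dots> \<le> ?b 0 * ?b (j + (n - Suc j))"
      by (rule log_convex_mult_le) (use nn walk_diag_log_convex[OF assms(1) i] in auto)
    also have "j + (n - Suc j) = n - 1" using j by simp
    finally show "walk_diag P G j i * ?b (n - Suc j) \<le> ?b 0 * ?b (n - 1)" .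
  qed
  finally show ?thesis by (simp add: walk_diag_def)
qed

text \<open>Cyclicity of the trace, together with \<open>P\<^sup>2 = P\<close>.\<close>

lemma sum_walk_diag_Suc:
  assumes "G \<subseteq> A"
  shows "(\<Sum>i\<in>A. walk_diag P G (Suc n) i) = (\<Sum>i\<in>G. walk_diag P G n i)"
proof -
  have "(\<Sum>i\<in>A. walk P G (Suc n) i i) = (\<Sum>k\<in>G. \<Sum>i\<in>A. walk P G n k i * walk P G 0 i k)"
    unfolding walk.simps by (subst sum.swap) (simp add: mult.commute)
  also have "\<dots> = (\<Sum>k\<in>G. walk P G n k k)"
    using assms by (intro sum.cong refl, subst walk_join) auto
  finally show ?thesis
    unfolding walk_diag_complex of_real_sum[symmetric] of_real_eq_iff .
qed

text \<open>The vector \<open>a\<close> is fixed by all the walk matrices, so their Hilbert-Schmidt norm is at least 1. The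
  square of that norm is the trace at the doubled, hence even, length.\<close>

lemma fixed_vector_imp_trace_ge_1:
  assumes G: "G \<subseteq> A" and zero: "\<And>i. i \<in> A - G \<Longrightarrow> a i = 0"
    and fixed: "\<And>i. i \<in> A \<Longrightarrow> (\<Sum>k\<in>A. P i k * a k) = a i"
    and nz: "i0 \<in> A" "a i0 \<noteq> 0"
  shows "1 \<le> (\<Sum>i\<in>A. walk_diag P G (2 * n) i)"
proof -
  have GA: "(\<Sum>k\<in>A. f k * a k) = (\<Sum>k\<in>G. f k * a k)" for f
    using G finite_A zero by (intro sum.mono_neutral_right) auto
  have walk_fixed: "(\<Sum>k\<in>A. walk P G m i k * a k) = a i" if "i \<in> A" for m i
    using that
  proof (induction m arbitrary: i)
    case (Suc m)
    have "(\<Sum>k\<in>A. walk P G (Suc m) i k * a k) = (\<Sum>l\<in>G. P i l * (\<Sum>k\<in>A. walk P G m l k * a k))"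
      unfolding walk.simps sum_distrib_left sum_distrib_right
      by (subst sum.swap) (simp add: mult.assoc)
    also have "\<dots> = (\<Sum>l\<in>G. P i l * a l)"
      using Suc G by (intro sum.cong) auto
    also have "\<dots> = a i"
      using fixed[OF Suc.prems] GA by simp
    finally show ?case .
  qed (use fixed in auto)
  let ?s = "\<Sum>k\<in>A. (cmod (a k))\<^sup>2"
  have "?s \<le> (\<Sum>i\<in>A. (\<Sum>l\<in>A. (cmod (walk P G n i l))\<^sup>2) * ?s)"
  proof (rule sum_mono)
    fix i assume "i \<in> A"
    show "(cmod (a i))\<^sup>2 \<le> (\<Sum>l\<in>A. (cmod (walk P G n i l))\<^sup>2) * ?s"
      using norm_sum_mult_le[of "walk P G n i" a A] unfolding walk_fixed[OF \<open>i \<in> A\<close>] .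
  qed
  also have "\<dots> = (\<Sum>i\<in>A. walk_diag P G (2 * n) i) * ?s"
    using walk_diag_even[OF G] by (simp add: sum_distrib_right)
  finally have "?s \<le> (\<Sum>i\<in>A. walk_diag P G (2 * n) i) * ?s" .
  moreover have "?s > 0"
    by (rule sum_pos2[OF finite_A nz(1)]) (use nz(2) in auto)
  ultimately show ?thesis by simp
qed

end

section \<open>Traces over a random index set\<close>

abbreviation mean :: "nat \<Rightarrow> real \<Rightarrow> (nat set \<Rightarrow> real) \<Rightarrow> real" where
  "mean N p F \<equiv> measure_pmf.expectation (bernoulli_subset N p) F"

lemma set_bernoulli_subset: "G \<in> set_pmf (bernoulli_subset N p) \<Longrightarrow> G \<subseteq> {..<N}"
  by (auto simp: bernoulli_subset_def)

lemma finite_set_bernoulli_subset: "finite (set_pmf (bernoulli_subset N p))"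
  by (rule finite_subset[of _ "Pow {..<N}"]) (auto dest: set_bernoulli_subset)

lemma integrable_bernoulli_subset [simp]:
  "integrable (measure_pmf (bernoulli_subset N p)) (F :: nat set \<Rightarrow> real)"
  by (rule integrable_measure_pmf_finite) (rule finite_set_bernoulli_subset)

lemma mean_mono:
  assumes "\<And>G. G \<subseteq> {..<N} \<Longrightarrow> F G \<le> F' G"
  shows "mean N p F \<le> mean N p F'"
  by (rule integral_mono_AE)
     (auto simp: AE_measure_pmf_iff intro!: assms dest: set_bernoulli_subset)

lemma prob_le_mean:
  assumes "\<And>G. G \<subseteq> {..<N} \<Longrightarrow> 0 \<le> F G" and "\<And>G. G \<subseteq> {..<N} \<Longrightarrow> Q G \<Longrightarrow> 1 \<le> F G"
  shows "measure_pmf.prob (bernoulli_subset N p) {G. Q G} \<le> mean N p F"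
proof -
  have "measure_pmf.prob (bernoulli_subset N p) {G. Q G} = mean N p (indicator {G. Q G})"
    by simp
  also have "\<dots> \<le> mean N p F"
    by (rule mean_mono) (use assms in \<open>auto simp: indicator_def\<close>)
  finally show ?thesis .
qed

text \<open>The event \<open>i \<in> G\<close> is independent of \<open>G - {i}\<close>.\<close>

lemma mean_thinning:
  assumes p: "0 \<le> p" "p \<le> 1" and i: "i < N"
  shows "mean N p (\<lambda>G. of_bool (i \<in> G) * F (G - {i})) = p * mean N p (\<lambda>G. F (G - {i}))"
proof -
  let ?B = "{..<N} - {i}"
  let ?Q = "Pi_pmf ?B False (\<lambda>_. bernoulli_pmf p)"
  let ?S = "\<lambda>I y. {j. j < N \<and> (if j = i then y else I j)}"
  have ins: "{..<N} = insert i ?B" using i by auto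
  \<comment> \<open>Condition on whether \<open>i\<close> is chosen.\<close>
  have split: "mean N p h = p * measure_pmf.expectation ?Q (\<lambda>I. h (?S I True)) +
      (1 - p) * measure_pmf.expectation ?Q (\<lambda>I. h (?S I False))" for h
  proof -
    have "bernoulli_subset N p = bernoulli_pmf p \<bind> (\<lambda>y. map_pmf (\<lambda>I. ?S I y) ?Q)"
      unfolding bernoulli_subset_def
      by (subst ins, subst Pi_pmf_insert')
         (auto simp: map_bind_pmf map_pmf_def bind_assoc_pmf bind_return_pmf fun_upd_def
           intro!: bind_pmf_cong arg_cong[where f = return_pmf])
    then have "mean N p h = (\<Sum>y\<in>UNIV. pmf (bernoulli_pmf p) y *\<^sub>R
        measure_pmf.expectation (map_pmf (\<lambda>I. ?S I y) ?Q) h)"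
      by (simp only:) (rule pmf_expectation_bind,
        auto simp: set_Pi_pmf intro!: finite_imageI finite_PiE_dflt)
    then show ?thesis using p by (simp add: UNIV_bool)
  qed
  have eq: "?S I True - {i} = ?S I False" "?S I False - {i} = ?S I False" for I
    by auto
  show ?thesis
    unfolding split eq using i by (simp add: eq algebra_simps)
qed

text \<open>Markov's inequality for \<open>2 ^ card G\<close>, whose mean is \<open>(1 + p) ^ N\<close>.\<close>

lemma prob_bernoulli_subset_card_ge:
  assumes p: "0 \<le> p" "p \<le> 1" and t: "0 \<le> t"
  shows "measure_pmf.prob (bernoulli_subset N p) {G. t \<le> real (card G)}
    \<le> exp (p * real N) / 2 powr t"
proof -
  let ?Q = "Pi_pmf {..<N} False (\<lambda>_. bernoulli_pmf p)"
  have c: "(2::real) ^ card {j \<in> {..<N}. I j} = (\<Prod>j<N. if I j then 2 else 1)" for I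
    by (simp add: prod.If_cases Int_def)
  have "mean N p (\<lambda>G. 2 ^ card G) = (\<Prod>j<N. measure_pmf.expectation (bernoulli_pmf p) (\<lambda>b. if b then 2 else 1))"
    unfolding bernoulli_subset_def integral_map_pmf c
    by (rule expectation_prod_Pi_pmf) (auto intro!: integrable_measure_pmf_finite)
  also have "\<dots> = (1 + p) ^ N"
    using p by (simp add: add.commute)
  also have "\<dots> \<le> exp p ^ N"
    using p by (intro power_mono exp_ge_add_one_self) auto
  finally have m: "mean N p (\<lambda>G. 2 ^ card G) \<le> exp (p * real N)"
    by (simp add: exp_of_nat_mult[symmetric] mult.commute)
  have "measure_pmf.prob (bernoulli_subset N p) {G. t \<le> real (card G)} \<le>
      mean N p (\<lambda>G. 2 ^ card G / 2 powr t)"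
    by (rule prob_le_mean) (auto simp: powr_realpow[symmetric] powr_mono)
  also have "\<dots> \<le> exp (p * real N) / 2 powr t"
    using m by (simp add: divide_right_mono)
  finally show ?thesis .
qed

locale projection_kernel_nat = projection_kernel "{..<N}" P for N :: nat and P +
  fixes R :: real
  assumes diag_le: "\<And>i. i < N \<Longrightarrow> Re (P i i) \<le> R" and R_nonneg: "0 \<le> R"
begin

text \<open>A step of the induction on the length: open the trace at an index \<open>i \<in> G\<close>, replace \<open>G\<close> by \<open>G - {i}\<close>
  in the remaining walk, and average over the event \<open>i \<in> G\<close> separately. The correction terms add up to
  the trace at length \<open>n\<close> again, so that the estimate closes without any control of higher moments.\<close>

lemma mean_trace_Suc_le:
  assumes p: "0 \<le> p" "p \<le> 1"
  shows "mean N p (\<lambda>G. \<Sum>i<N. walk_diag P G (Suc n) i)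
    \<le> (p + real n * R) * mean N p (\<lambda>G. \<Sum>i<N. walk_diag P G n i)"
proof -
  let ?d = "walk_diag P"
  have in_sum: "(\<Sum>i\<in>G. ?d G m i) = (\<Sum>i<N. of_bool (i \<in> G) * ?d G m i)" if "G \<subseteq> {..<N}" for G m
    using that by (intro sum.mono_neutral_cong_left) auto
  have step: "of_bool (i \<in> G) * ?d G n i \<le>
      of_bool (i \<in> G) * ?d (G - {i}) n i + real n * R * (of_bool (i \<in> G) * ?d G (n - 1) i)"
    if "i < N" "G \<subseteq> {..<N}" for i G
  proof (cases "i \<in> G")
    case True
    then have ins: "insert i (G - {i}) = G" by auto
    have "?d G n i \<le> ?d (G - {i}) n i + real n * Re (P i i) * ?d G (n - 1) i"
      using walk_diag_insert_le[of i "G - {i}" n, unfolded ins] that by auto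
    also have "real n * Re (P i i) * ?d G (n - 1) i \<le> real n * R * ?d G (n - 1) i"
      using that diag_le[of i] walk_diag_nonneg[of G i] by (intro mult_right_mono mult_left_mono) auto
    finally show ?thesis using True by simp
  qed simp
  have mono: "?d (G - {i}) n i \<le> ?d G n i" if "i < N" "G \<subseteq> {..<N}" for i G
  proof (cases "i \<in> G")
    case True
    then have ins: "insert i (G - {i}) = G" by auto
    show ?thesis using walk_diag_insert_mono[of i "G - {i}" n, unfolded ins] that by auto
  qed simp
  have last: "real n * mean N p (\<lambda>G. \<Sum>i<N. of_bool (i \<in> G) * ?d G (n - 1) i) =
      real n * mean N p (\<lambda>G. \<Sum>i<N. ?d G n i)"
  proof (cases n)
    case (Suc m)
    have "mean N p (\<lambda>G. \<Sum>i<N. of_bool (i \<in> G) * ?d G m i) = mean N p (\<lambda>G. \<Sum>i<N. ?d G (Suc m) i)"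
      by (intro integral_cong_AE)
         (auto simp: AE_measure_pmf_iff sum_walk_diag_Suc in_sum dest!: set_bernoulli_subset)
    then show ?thesis using Suc by simp
  qed simp
  have linear: "mean N p (\<lambda>G. \<Sum>i<N. F i G + c * F' i G) =
      (\<Sum>i<N. mean N p (F i)) + c * mean N p (\<lambda>G. \<Sum>i<N. F' i G)" for F F' c
    by (simp add: sum.distrib sum_distrib_left)
  have "mean N p (\<lambda>G. \<Sum>i<N. ?d G (Suc n) i) \<le>
      mean N p (\<lambda>G. \<Sum>i<N. of_bool (i \<in> G) * ?d (G - {i}) n i +
        real n * R * (of_bool (i \<in> G) * ?d G (n - 1) i))"
    by (rule mean_mono) (simp only: sum_walk_diag_Suc in_sum, intro sum_mono step, auto)
  also have "\<dots> = (\<Sum>i<N. p * mean N p (\<lambda>G. ?d (G - {i}) n i)) +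
      R * (real n * mean N p (\<lambda>G. \<Sum>i<N. of_bool (i \<in> G) * ?d G (n - 1) i))"
    unfolding linear using mean_thinning[OF p, of _ N "\<lambda>G. ?d G n _"]
    by (intro arg_cong2[where f = "(+)"] sum.cong) auto
  also have "\<dots> \<le> (\<Sum>i<N. p * mean N p (\<lambda>G. ?d G n i)) + R * (real n * mean N p (\<lambda>G. \<Sum>i<N. ?d G n i))"
    unfolding last
    by (intro add_right_mono sum_mono mult_left_mono mean_mono mono p) auto
  also have "\<dots> = (p + real n * R) * mean N p (\<lambda>G. \<Sum>i<N. ?d G n i)"
    by (simp add: sum_distrib_left[symmetric] algebra_simps)
  finally show ?thesis .
qed

lemma mean_trace_le:
  assumes p: "0 \<le> p" "p \<le> 1" and n: "n \<le> K"
  shows "mean N p (\<lambda>G. \<Sum>i<N. walk_diag P G n i) \<le> (p + real K * R) ^ n * (\<Sum>i<N. Re (P i i))"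
  using n
proof (induction n)
  case 0
  show ?case by (simp add: walk_diag_def)
next
  case (Suc n)
  have nn: "0 \<le> mean N p (\<lambda>G. \<Sum>i<N. walk_diag P G n i)"
    by (intro integral_nonneg_AE)
      (auto simp: AE_measure_pmf_iff intro!: sum_nonneg walk_diag_nonneg dest!: set_bernoulli_subset)
  have "mean N p (\<lambda>G. \<Sum>i<N. walk_diag P G (Suc n) i)
      \<le> (p + real n * R) * mean N p (\<lambda>G. \<Sum>i<N. walk_diag P G n i)"
    by (rule mean_trace_Suc_le[OF p])
  also have "\<dots> \<le> (p + real K * R) * ((p + real K * R) ^ n * (\<Sum>i<N. Re (P i i)))"
    using Suc p R_nonneg nn by (intro mult_mono add_left_mono mult_right_mono) auto
  finally show ?case by (simp add: mult.assoc)
qed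

text \<open>Markov's inequality for the trace, which is at least 1 on the event in question.\<close>

lemma prob_fixed_vector_le:
  assumes p: "0 \<le> p" "p \<le> 1"
  shows "measure_pmf.prob (bernoulli_subset N p)
      {G. \<exists>a. (\<forall>i\<in>{..<N} - G. a i = 0) \<and> (\<forall>i<N. (\<Sum>k<N. P i k * a k) = a i) \<and> (\<exists>i<N. a i \<noteq> 0)}
    \<le> (p + real (2 * n) * R) ^ (2 * n) * (\<Sum>i<N. Re (P i i))"
  (is "measure_pmf.prob _ {G. ?Q G} \<le> _")
proof -
  have "measure_pmf.prob (bernoulli_subset N p) {G. ?Q G} \<le> mean N p (\<lambda>G. \<Sum>i<N. walk_diag P G (2 * n) i)"
  proof (rule prob_le_mean)
    fix G assume G: "G \<subseteq> {..<N}"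
    show "0 \<le> (\<Sum>i<N. walk_diag P G (2 * n) i)"
      using G by (intro sum_nonneg walk_diag_nonneg) auto
    assume "?Q G"
    then obtain a i where a: "\<forall>i\<in>{..<N} - G. a i = 0" "\<forall>i<N. (\<Sum>k<N. P i k * a k) = a i"
      and i: "i < N" "a i \<noteq> 0" by blast
    show "1 \<le> (\<Sum>i<N. walk_diag P G (2 * n) i)"
      by (rule fixed_vector_imp_trace_ge_1[OF G, of a i]) (use a i in auto)
  qed
  also have "\<dots> \<le> (p + real (2 * n) * R) ^ (2 * n) * (\<Sum>i<N. Re (P i i))"
    by (rule mean_trace_le[OF p]) simp
  finally show ?thesis .
qed

end

section \<open>Uncertainty for two orthonormal bases\<close>

definition orthonormal_rows :: "nat \<Rightarrow> (nat \<Rightarrow> nat \<Rightarrow> complex) \<Rightarrow> bool" where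
  "orthonormal_rows N a \<longleftrightarrow>
    (\<forall>i<N. \<forall>j<N. (\<Sum>k<N. a i k * cnj (a j k)) = (if i = j then 1 else 0))"

text \<open>A one-sided inverse of a square matrix is two-sided.\<close>

lemma orthonormal_columns:
  assumes "orthonormal_rows N a" "k < N" "l < N"
  shows "(\<Sum>i<N. cnj (a i k) * a i l) = (if k = l then 1 else 0)"
proof -
  let ?A = "mat N N (\<lambda>(i, k). a i k)" and ?B = "mat N N (\<lambda>(k, j). cnj (a j k))"
  have "?A * ?B = 1\<^sub>m N"
    using assms(1)
    by (intro eq_matI) (auto simp: orthonormal_rows_def scalar_prod_def atLeast0LessThan)
  then have "?B * ?A = 1\<^sub>m N"
    by (intro mat_mult_left_right_inverse[of ?A N ?B]) auto
  then have "(?B * ?A) $$ (k, l) = 1\<^sub>m N $$ (k, l)"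
    by simp
  then show ?thesis
    using assms by (simp add: scalar_prod_def atLeast0LessThan)
qed

lemma cross_gram_orthonormal_columns:
  assumes e: "orthonormal_rows N e" and f: "orthonormal_rows N f" and j: "j < N" "j' < N"
  defines "U \<equiv> \<lambda>i j. \<Sum>k<N. f j k * cnj (e i k)"
  shows "(\<Sum>i<N. cnj (U i j) * U i j') = (if j = j' then 1 else 0)"
proof -
  have "(\<Sum>i<N. cnj (U i j) * U i j') =
      (\<Sum>i<N. \<Sum>l<N. \<Sum>k<N. (cnj (f j k) * f j' l) * (cnj (e i l) * e i k))"
    unfolding U_def cnj_sum sum_distrib_left sum_distrib_right
    by (intro sum.cong refl) (simp add: mult_ac)
  also have "\<dots> = (\<Sum>l<N. \<Sum>i<N. \<Sum>k<N. (cnj (f j k) * f j' l) * (cnj (e i l) * e i k))"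
    by (rule sum.swap)
  also have "\<dots> = (\<Sum>l<N. \<Sum>k<N. \<Sum>i<N. (cnj (f j k) * f j' l) * (cnj (e i l) * e i k))"
    by (intro sum.cong refl sum.swap)
  also have "\<dots> = (\<Sum>l<N. \<Sum>k<N. (cnj (f j k) * f j' l) * (if l = k then 1 else 0))"
    using orthonormal_columns[OF e] by (intro sum.cong refl) (simp flip: sum_distrib_left)
  also have "\<dots> = (\<Sum>l<N. f j' l * cnj (f j l))"
    by (simp add: if_distrib mult.commute cong: if_cong)
  also have "\<dots> = (if j = j' then 1 else 0)"
    using f j by (auto simp: orthonormal_rows_def)
  finally show ?thesis .
qed

text \<open>A nonzero vector that lives on \<open>H\<close> in one basis and on \<open>G\<close> in the other is, in the coordinates of
  \<open>G\<close>, a fixed vector of the projection onto the span of the columns of \<open>U\<close> in \<open>H\<close>. The diagonal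
  entries of that projection are sums of \<open>card H\<close> squared inner products, and its trace is \<open>card H\<close>.\<close>

lemma prob_uncertainty_le:
  assumes U: "\<And>j j'. j < N \<Longrightarrow> j' < N \<Longrightarrow> (\<Sum>i<N. cnj (U i j) * U i j') = (if j = j' then 1 else 0)"
    and bound: "\<And>i j. i < N \<Longrightarrow> j < N \<Longrightarrow> cmod (U i j) \<le> \<mu>"
    and H: "H \<subseteq> {..<N}" and p: "0 \<le> p" "p \<le> 1"
  shows "measure_pmf.prob (bernoulli_subset N p)
      {G. \<exists>b. (\<exists>j\<in>H. b j \<noteq> 0) \<and> (\<forall>i\<in>{..<N} - G. (\<Sum>j\<in>H. U i j * b j) = 0)}
    \<le> (p + real (2 * n) * (real (card H) * \<mu>\<^sup>2)) ^ (2 * n) * real (card H)"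
proof -
  define P where "P i k = (\<Sum>j\<in>H. U i j * cnj (U k j))" for i k
  have finH: "finite H" using H finite_subset by blast
  have diag: "P i i = of_real (\<Sum>j\<in>H. (cmod (U i j))\<^sup>2)" for i
    unfolding P_def of_real_sum complex_norm_square ..
  have PU: "(\<Sum>k<N. P i k * U k j) = U i j" if "j \<in> H" for i j
  proof -
    have "(\<Sum>k<N. P i k * U k j) = (\<Sum>j'\<in>H. U i j' * (\<Sum>k<N. cnj (U k j') * U k j))"
      unfolding P_def sum_distrib_left sum_distrib_right
      by (subst sum.swap) (simp add: mult.assoc)
    also have "\<dots> = (\<Sum>j'\<in>H. U i j' * (if j' = j then 1 else 0))"
      by (intro sum.cong refl arg_cong2[where f = "(*)"] U) (use H that in auto)
    finally show ?thesis using that finH by (simp add: if_distrib cong: if_cong)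
  qed
  interpret projection_kernel_nat N P "real (card H) * \<mu>\<^sup>2"
  proof
    show "P j i = cnj (P i j)" for i j
      by (simp add: P_def mult.commute)
    show "(\<Sum>k<N. P i k * P k j) = P i j" if "i \<in> {..<N}" "j \<in> {..<N}" for i j
    proof -
      have "(\<Sum>k<N. P i k * P k j) = (\<Sum>l\<in>H. (\<Sum>k<N. P i k * U k l) * cnj (U j l))"
        unfolding sum_distrib_right
        by (subst sum.swap) (simp add: P_def[of _ j] sum_distrib_left mult.assoc)
      then show ?thesis by (simp add: PU) (simp add: P_def)
    qed
    show "Re (P i i) \<le> real (card H) * \<mu>\<^sup>2" if "i < N" for i
      unfolding diag Re_complex_of_real
      using bound[OF that] H by (intro sum_bounded_above power_mono) auto
  qed auto
  have trace: "(\<Sum>i<N. Re (P i i)) = real (card H)"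
  proof -
    have "(\<Sum>i<N. P i i) = (\<Sum>j\<in>H. \<Sum>i<N. cnj (U i j) * U i j)"
      unfolding P_def by (subst sum.swap) (simp add: mult.commute)
    also have "\<dots> = (\<Sum>j\<in>H. 1)"
      using U H by (intro sum.cong refl) auto
    finally have "(\<Sum>i<N. P i i) = of_nat (card H)" by simp
    from arg_cong[OF this, of Re] show ?thesis by simp
  qed
  have "measure_pmf.prob (bernoulli_subset N p)
      {G. \<exists>b. (\<exists>j\<in>H. b j \<noteq> 0) \<and> (\<forall>i\<in>{..<N} - G. (\<Sum>j\<in>H. U i j * b j) = 0)}
    \<le> measure_pmf.prob (bernoulli_subset N p)
      {G. \<exists>a. (\<forall>i\<in>{..<N} - G. a i = 0) \<and> (\<forall>i<N. (\<Sum>k<N. P i k * a k) = a i) \<and> (\<exists>i<N. a i \<noteq> 0)}"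
  proof (rule measure_pmf.finite_measure_mono, safe)
    fix G b j assume j: "j \<in> H" "b j \<noteq> 0" and z: "\<forall>i\<in>{..<N} - G. (\<Sum>j\<in>H. U i j * b j) = 0"
    define a where "a i = (\<Sum>j\<in>H. U i j * b j)" for i
    have "(\<Sum>k<N. P i k * a k) = a i" for i
    proof -
      have "(\<Sum>k<N. P i k * a k) = (\<Sum>j\<in>H. (\<Sum>k<N. P i k * U k j) * b j)"
        unfolding a_def sum_distrib_left sum_distrib_right
        by (subst sum.swap) (simp add: mult.assoc)
      then show ?thesis by (simp add: PU a_def)
    qed
    moreover have "\<exists>i<N. a i \<noteq> 0"
    proof (rule ccontr)
      assume "\<not> (\<exists>i<N. a i \<noteq> 0)"
      then have "0 = (\<Sum>i<N. cnj (U i j) * a i)" by simp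
      also have "\<dots> = (\<Sum>l\<in>H. (\<Sum>i<N. cnj (U i j) * U i l) * b l)"
        unfolding a_def sum_distrib_left sum_distrib_right
        by (subst sum.swap) (simp add: mult.assoc)
      also have "\<dots> = (\<Sum>l\<in>H. (if j = l then 1 else 0) * b l)"
        by (intro sum.cong refl arg_cong2[where f = "(*)"] U) (use H j in auto)
      also have "\<dots> = (\<Sum>l\<in>H. if j = l then b l else 0)"
        by (intro sum.cong refl) simp
      also have "\<dots> = b j" using j finH by simp
      finally show False using j by simp
    qed
    ultimately show "\<exists>a. (\<forall>i\<in>{..<N} - G. a i = 0) \<and> (\<forall>i<N. (\<Sum>k<N. P i k * a k) = a i) \<and> (\<exists>i<N. a i \<noteq> 0)"
      using z unfolding a_def[symmetric] by (intro exI[of _ a]) auto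
  qed simp
  also have "\<dots> \<le> (p + real (2 * n) * (real (card H) * \<mu>\<^sup>2)) ^ (2 * n) * (\<Sum>i<N. Re (P i i))"
    by (rule prob_fixed_vector_le[OF p])
  finally show ?thesis unfolding trace .
qed

text \<open>The coefficients of the two families are kept apart, so that the roles of the bases can be exchanged.\<close>

definition dependent_pair ::
    "nat \<Rightarrow> (nat \<Rightarrow> nat \<Rightarrow> complex) \<Rightarrow> (nat \<Rightarrow> nat \<Rightarrow> complex) \<Rightarrow> nat set \<Rightarrow> nat set \<Rightarrow> bool" where
  "dependent_pair N e f G H \<longleftrightarrow> (\<exists>y z. ((\<exists>i\<in>G. y i \<noteq> 0) \<or> (\<exists>j\<in>H. z j \<noteq> 0)) \<and>
     (\<forall>k<N. (\<Sum>i\<in>G. y i * e i k) + (\<Sum>j\<in>H. z j * f j k) = 0))"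

lemma dependent_pair_sym: "dependent_pair N e f G H \<longleftrightarrow> dependent_pair N f e H G"
  unfolding dependent_pair_def by (subst ex_comm) (simp add: add.commute disj_commute)

text \<open>Taking inner products with \<open>e i\<close> expresses the first group of coefficients through the second, and
  makes the combination of the second group vanish at every index outside \<open>G\<close>.\<close>

lemma dependent_pair_imp_uncertainty:
  assumes e: "orthonormal_rows N e" and G: "G \<subseteq> {..<N}"
    and dep: "dependent_pair N e f G H"
  shows "\<exists>b. (\<exists>j\<in>H. b j \<noteq> 0) \<and>
    (\<forall>i\<in>{..<N} - G. (\<Sum>j\<in>H. (\<Sum>k<N. f j k * cnj (e i k)) * b j) = 0)"
proof -
  obtain y z where nz: "(\<exists>i\<in>G. y i \<noteq> 0) \<or> (\<exists>j\<in>H. z j \<noteq> 0)"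
    and eq: "\<And>k. k < N \<Longrightarrow> (\<Sum>i\<in>G. y i * e i k) + (\<Sum>j\<in>H. z j * f j k) = 0"
    using dep unfolding dependent_pair_def by blast
  have finG: "finite G" using G finite_subset by blast
  have coef: "(if i \<in> G then y i else 0) + (\<Sum>j\<in>H. (\<Sum>k<N. f j k * cnj (e i k)) * z j) = 0"
    if i: "i < N" for i
  proof -
    have "0 = (\<Sum>k<N. ((\<Sum>l\<in>G. y l * e l k) + (\<Sum>j\<in>H. z j * f j k)) * cnj (e i k))"
      using eq by simp
    also have "\<dots> = (\<Sum>k<N. \<Sum>l\<in>G. y l * (e l k * cnj (e i k))) +
        (\<Sum>k<N. \<Sum>j\<in>H. f j k * cnj (e i k) * z j)"
      unfolding distrib_right sum_distrib_right sum.distrib by (simp add: mult_ac)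
    also have "(\<Sum>k<N. \<Sum>l\<in>G. y l * (e l k * cnj (e i k))) = (\<Sum>l\<in>G. y l * (\<Sum>k<N. e l k * cnj (e i k)))"
      unfolding sum_distrib_left by (rule sum.swap)
    also have "\<dots> = (\<Sum>l\<in>G. y l * (if l = i then 1 else 0))"
      using e G i by (intro sum.cong refl) (auto simp: orthonormal_rows_def)
    also have "\<dots> = (if i \<in> G then y i else 0)"
      using finG by (simp add: if_distrib cong: if_cong)
    also have "(\<Sum>k<N. \<Sum>j\<in>H. f j k * cnj (e i k) * z j) = (\<Sum>j\<in>H. (\<Sum>k<N. f j k * cnj (e i k)) * z j)"
      unfolding sum_distrib_right by (rule sum.swap)
    finally show ?thesis by simp
  qed
  have "\<exists>j\<in>H. z j \<noteq> 0"
  proof (rule ccontr)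
    assume "\<not> ?thesis"
    then have "y i = 0" if "i \<in> G" for i
      using coef[of i] that G by auto
    with nz \<open>\<not> ?thesis\<close> show False by blast
  qed
  moreover have "\<forall>i\<in>{..<N} - G. (\<Sum>j\<in>H. (\<Sum>k<N. f j k * cnj (e i k)) * z j) = 0"
  proof
    fix i assume "i \<in> {..<N} - G"
    then show "(\<Sum>j\<in>H. (\<Sum>k<N. f j k * cnj (e i k)) * z j) = 0"
      using coef[of i] by simp
  qed
  ultimately show ?thesis by blast
qed

lemma prob_dependent_pair_le:
  assumes e: "orthonormal_rows N e" and f: "orthonormal_rows N f"
    and bound: "\<And>i j. i < N \<Longrightarrow> j < N \<Longrightarrow> cmod (\<Sum>k<N. f j k * cnj (e i k)) \<le> \<mu>"
    and H: "H \<subseteq> {..<N}" and p: "0 \<le> p" "p \<le> 1"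
  shows "measure_pmf.prob (bernoulli_subset N p) {G. dependent_pair N e f G H}
    \<le> (p + real (2 * n) * (real (card H) * \<mu>\<^sup>2)) ^ (2 * n) * real (card H)"
proof -
  have "measure_pmf.prob (bernoulli_subset N p) {G. dependent_pair N e f G H} \<le>
    measure_pmf.prob (bernoulli_subset N p) {G. \<exists>b. (\<exists>j\<in>H. b j \<noteq> 0) \<and>
      (\<forall>i\<in>{..<N} - G. (\<Sum>j\<in>H. (\<Sum>k<N. f j k * cnj (e i k)) * b j) = 0)}"
    by (rule measure_pmf.finite_measure_mono_AE)
       (auto simp: AE_measure_pmf_iff
         intro!: dependent_pair_imp_uncertainty[OF e] dest!: set_bernoulli_subset)
  also have "\<dots> \<le> (p + real (2 * n) * (real (card H) * \<mu>\<^sup>2)) ^ (2 * n) * real (card H)"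
    by (rule prob_uncertainty_le[OF cross_gram_orthonormal_columns[OF e f] bound H p])
  finally show ?thesis .
qed

section \<open>Linear independence on a random support\<close>

text \<open>Condition on the second coordinate and discard its exceptional values.\<close>

lemma prob_pair_pmf_le:
  assumes Q: "\<And>y. y \<in> set_pmf B \<Longrightarrow> \<not> E y \<Longrightarrow> measure_pmf.prob A {x. Q x y} \<le> \<epsilon>"
    and E: "measure_pmf.prob B {y. E y} \<le> \<delta>" and nonneg: "0 \<le> \<epsilon>"
  shows "measure_pmf.prob (pair_pmf A B) {(x, y). Q x y} \<le> \<epsilon> + \<delta>"
proof -
  have "emeasure (measure_pmf (pair_pmf A B)) {(x, y). Q x y} =
      emeasure (measure_pmf (pair_pmf B A)) {(y, x). Q x y}"
    by (subst pair_commute_pmf) (auto intro!: arg_cong2[where f = emeasure])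
  also have "\<dots> = (\<integral>\<^sup>+z. indicator {(y, x). Q x y} z \<partial>measure_pmf (pair_pmf B A))"
    by simp
  also have "\<dots> = (\<integral>\<^sup>+y. \<integral>\<^sup>+x. indicator {x. Q x y} x \<partial>measure_pmf A \<partial>measure_pmf B)"
    unfolding nn_integral_pair_pmf' by (simp add: indicator_def)
  also have "\<dots> = (\<integral>\<^sup>+y. emeasure (measure_pmf A) {x. Q x y} \<partial>measure_pmf B)"
    by simp
  also have "\<dots> \<le> (\<integral>\<^sup>+y. ennreal \<epsilon> + indicator {y. E y} y \<partial>measure_pmf B)"
  proof (rule nn_integral_mono_AE, rule AE_pmfI)
    fix y assume y: "y \<in> set_pmf B"
    show "emeasure (measure_pmf A) {x. Q x y} \<le> ennreal \<epsilon> + indicator {y. E y} y"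
    proof (cases "E y")
      case True
      have "emeasure (measure_pmf A) {x. Q x y} \<le> 1"
        by (rule measure_pmf.emeasure_le_1)
      then show ?thesis using True by (simp add: add_increasing)
    next
      case False
      then show ?thesis
        using Q[OF y] by (simp add: measure_pmf.emeasure_eq_measure ennreal_leI)
    qed
  qed
  also have "\<dots> = ennreal \<epsilon> + emeasure (measure_pmf B) {y. E y}"
    by (subst nn_integral_add) auto
  also have "\<dots> \<le> ennreal \<epsilon> + ennreal \<delta>"
    using E by (intro add_left_mono) (simp add: measure_pmf.emeasure_eq_measure ennreal_leI)
  also have "\<dots> = ennreal (\<epsilon> + \<delta>)"
    using E nonneg by (intro ennreal_plus[symmetric]) (auto intro: order_trans[OF measure_nonneg])
  finally have "ennreal (measure_pmf.prob (pair_pmf A B) {(x, y). Q x y}) \<le> ennreal (\<epsilon> + \<delta>)"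
    unfolding measure_pmf.emeasure_eq_measure .
  moreover have "0 \<le> \<delta>"
    using E order_trans[OF measure_nonneg] by blast
  ultimately show ?thesis
    using nonneg by (subst (asm) ennreal_le_iff) auto
qed

text \<open>The entries of a unitary \<open>N \<times> N\<close> matrix have mean square \<open>1 / N\<close>. This turns the bound on the expected
  support size into a bound on the sampling probabilities themselves.\<close>

lemma coherence_square_ge:
  assumes e: "orthonormal_rows N e" and f: "orthonormal_rows N f" and N: "0 < N"
    and bound: "\<And>i j. i < N \<Longrightarrow> j < N \<Longrightarrow> cmod (\<Sum>k<N. f j k * cnj (e i k)) \<le> \<mu>"
  shows "1 \<le> real N * \<mu>\<^sup>2"
proof -
  let ?U = "\<lambda>i j. \<Sum>k<N. f j k * cnj (e i k)"
  have "(\<Sum>i<N. of_real ((cmod (?U i 0))\<^sup>2)) = (\<Sum>i<N. cnj (?U i 0) * ?U i 0)"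
    unfolding complex_norm_square by (simp only: mult.commute)
  also have "\<dots> = 1"
    using cross_gram_orthonormal_columns[OF e f N N] by simp
  finally have "complex_of_real (\<Sum>i<N. (cmod (?U i 0))\<^sup>2) = of_real 1"
    by (simp only: of_real_sum of_real_1)
  then have "(\<Sum>i<N. (cmod (?U i 0))\<^sup>2) = 1"
    by (simp only: of_real_eq_iff)
  then have "1 = (\<Sum>i<N. (cmod (?U i 0))\<^sup>2)" ..
  also have "\<dots> \<le> real (card {..<N}) * \<mu>\<^sup>2"
    using bound N by (intro sum_bounded_above power_mono) auto
  finally show ?thesis by simp
qed

text \<open>Condition on \<open>T\<close>, which has fewer than \<open>4 q N\<close> elements outside an event of probability at most \<open>N powr (- \<beta>)\<close>;
  then bound the probability over \<open>S\<close> for each of the \<open>N\<close> possible additional columns.\<close>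

lemma prob_extended_dependent_pair_le:
  fixes \<beta> \<mu> p q :: real
  assumes e: "orthonormal_rows N e" and f: "orthonormal_rows N f"
    and bound: "\<And>i j. i < N \<Longrightarrow> j < N \<Longrightarrow> cmod (\<Sum>k<N. f j k * cnj (e i k)) \<le> \<mu>"
    and N: "3 \<le> N" and \<beta>: "1 \<le> \<beta>"
    and p: "0 \<le> p" "p \<le> 1" and q: "0 \<le> q" "q \<le> 1"
    and qN: "4 * (\<beta> + 1) * ln (real N) \<le> q * real N"
    and small: "(p * real N + q * real N) * \<mu>\<^sup>2 * (300 * (\<beta> + 1) * ln (real N)) \<le> 1"
  shows "measure_pmf.prob (pair_pmf (bernoulli_subset N p) (bernoulli_subset N q))
      {(S, T). \<exists>j<N. dependent_pair N e f S (insert j T)} \<le> 2 * real N powr (- \<beta>)"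
proof -
  define L where "L = (\<beta> + 1) * ln (real N)"
  have lnN: "1 \<le> ln (real N)"
  proof -
    have "exp 1 \<le> real N" using exp_le N by linarith
    then show ?thesis using N by (subst ln_ge_iff) auto
  qed
  have L1: "2 \<le> L"
    unfolding L_def using lnN \<beta> mult_mono[of 2 "\<beta> + 1" 1 "ln (real N)"] by simp
  have qL: "4 * L \<le> q * real N" using qN unfolding L_def mult.assoc .
  have N\<mu>: "1 \<le> real N * \<mu>\<^sup>2"
    by (rule coherence_square_ge[OF e f _ bound]) (use N in auto)
  \<comment> \<open>Both \<open>p\<close> and the diagonal bound \<open>R\<close> are multiples of this quantity, which is at most \<open>1 / (300 L)\<close>.\<close>
  define x where "x = (p * real N + q * real N) * \<mu>\<^sup>2"
  have x: "0 \<le> x" "x * (300 * L) \<le> 1"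
    using small p q unfolding x_def L_def mult.assoc by auto
  have xp: "p \<le> x"
  proof -
    have "p * 1 \<le> p * (real N * \<mu>\<^sup>2)" using N\<mu> p by (intro mult_left_mono) auto
    also have "\<dots> \<le> x" using q by (simp add: x_def algebra_simps)
    finally show ?thesis by simp
  qed
  have xq: "q * real N * \<mu>\<^sup>2 \<le> x" using p by (simp add: x_def algebra_simps)
  \<comment> \<open>The trace is evaluated at length \<open>2 n\<close>, about \<open>2 L\<close>, so that a rate of \<open>exp (- 2)\<close> per step yields \<open>exp (- 4 L)\<close>.\<close>
  define n where "n = nat \<lceil>L\<rceil>"
  have n: "L \<le> real n" "real n \<le> L + 1"
    using L1 by (auto simp: n_def of_nat_nat)
  have exp_L: "exp (- L) = real N powr (- (\<beta> + 1))"
    using N by (simp add: powr_def L_def algebra_simps)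
  have tail: "measure_pmf.prob (bernoulli_subset N q) {T. 4 * (q * real N) \<le> real (card T)} \<le> real N powr (- \<beta>)"
  proof -
    have "measure_pmf.prob (bernoulli_subset N q) {T. 4 * (q * real N) \<le> real (card T)}
        \<le> exp (q * real N) / 2 powr (4 * (q * real N))"
      using q by (intro prob_bernoulli_subset_card_ge) auto
    also have "\<dots> = exp (q * real N - 4 * (q * real N) * ln 2)"
      by (simp add: powr_def exp_diff)
    also have "\<dots> \<le> exp (- L)"
    proof -
      have "q * real N * (2/3) \<le> q * real N * ln 2"
        using q ln2_ge_two_thirds by (intro mult_left_mono) auto
      then show ?thesis using qL L1 by simp
    qed
    also have "\<dots> \<le> real N powr (- \<beta>)"
      unfolding exp_L using N by (intro powr_mono) auto
    finally show ?thesis .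
  qed
  have main: "measure_pmf.prob (bernoulli_subset N p) {S. \<exists>j<N. dependent_pair N e f S (insert j T)}
      \<le> real N powr (- \<beta>)"
    if T: "T \<subseteq> {..<N}" "real (card T) < 4 * (q * real N)" for T
  proof -
    have one: "measure_pmf.prob (bernoulli_subset N p) {S. dependent_pair N e f S (insert j T)}
        \<le> exp (- 4 * L) * real N" if j: "j < N" for j
    proof -
      let ?H = "insert j T"
      have H: "?H \<subseteq> {..<N}" using T j by auto
      have "real (card ?H) \<le> real (card T) + 1"
        using card_insert_le_m1[of "Suc (card T)" T j] by simp
      also have "\<dots> \<le> 5 * (q * real N)" using T(2) qL L1 by linarith
      finally have "real (card ?H) * \<mu>\<^sup>2 \<le> 5 * (q * real N) * \<mu>\<^sup>2"
        by (rule mult_right_mono) simp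
      also have "\<dots> \<le> 5 * x" using xq by simp
      finally have R: "real (card ?H) * \<mu>\<^sup>2 \<le> 5 * x" .
      have "p + real (2 * n) * (real (card ?H) * \<mu>\<^sup>2) \<le> x + (2 * (L + 1)) * (5 * x)"
        using xp n L1 by (intro add_mono mult_mono[OF _ R]) auto
      also have "\<dots> \<le> 21 / 300"
        using x mult_right_mono[of 2 L x] L1 by (simp add: algebra_simps)
      also have "\<dots> \<le> exp (- 2 :: real)"
      proof -
        have "exp (2 :: real) = exp 1 * exp 1" by (simp flip: exp_add)
        also have "\<dots> \<le> 3 * 3" using exp_le by (intro mult_mono) auto
        finally show ?thesis by (simp add: exp_minus field_simps)
      qed
      finally have rate: "p + real (2 * n) * (real (card ?H) * \<mu>\<^sup>2) \<le> exp (- 2)" .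
      have "measure_pmf.prob (bernoulli_subset N p) {S. dependent_pair N e f S ?H}
          \<le> (p + real (2 * n) * (real (card ?H) * \<mu>\<^sup>2)) ^ (2 * n) * real (card ?H)"
        by (rule prob_dependent_pair_le[OF e f bound H p])
      also have "\<dots> \<le> exp (- 2) ^ (2 * n) * real N"
        using rate p card_mono[OF _ H] by (intro mult_mono power_mono) auto
      also have "exp (- 2 :: real) ^ (2 * n) = exp (- 4 * real n)"
        by (simp add: exp_of_nat_mult[symmetric])
      also have "exp (- 4 * real n) * real N \<le> exp (- 4 * L) * real N"
        using n by (intro mult_right_mono) auto
      finally show ?thesis by simp
    qed
    have "measure_pmf.prob (bernoulli_subset N p) {S. \<exists>j<N. dependent_pair N e f S (insert j T)}
        = measure_pmf.prob (bernoulli_subset N p) (\<Union>j\<in>{..<N}. {S. dependent_pair N e f S (insert j T)})"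
      by (rule arg_cong[where f = "measure_pmf.prob _"]) auto
    also have "\<dots> \<le> (\<Sum>j<N. measure_pmf.prob (bernoulli_subset N p) {S. dependent_pair N e f S (insert j T)})"
      by (rule measure_pmf.finite_measure_subadditive_finite) auto
    also have "\<dots> \<le> real (card {..<N}) * (exp (- 4 * L) * real N)"
      using one by (intro sum_bounded_above) auto
    also have "\<dots> = real N powr 2 * exp (- 4 * L)"
      using N by (simp add: powr_numeral power2_eq_square)
    also have "exp (- 4 * L) = real N powr (- 4 * (\<beta> + 1))"
      using N by (simp add: powr_def L_def algebra_simps)
    also have "real N powr 2 * real N powr (- 4 * (\<beta> + 1)) = real N powr (2 - 4 * (\<beta> + 1))"
      by (subst powr_add[symmetric]) simp
    also have "\<dots> \<le> real N powr (- \<beta>)"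
      using N \<beta> by (intro powr_mono) auto
    finally show ?thesis .
  qed
  have "measure_pmf.prob (pair_pmf (bernoulli_subset N p) (bernoulli_subset N q))
      {(S, T). \<exists>j<N. dependent_pair N e f S (insert j T)} \<le> real N powr (- \<beta>) + real N powr (- \<beta>)"
    by (rule prob_pair_pmf_le[where E = "\<lambda>T. 4 * (q * real N) \<le> real (card T)"])
       (use tail in \<open>auto intro!: main dest!: set_bernoulli_subset\<close>)
  then show ?thesis by simp
qed

text \<open>The additional column may belong to either basis; exchanging the bases reduces the second case to the
  first.\<close>

lemma prob_extended_dependent_pair_either_le:
  fixes \<beta> \<mu> p q :: real
  assumes e: "orthonormal_rows N e" and f: "orthonormal_rows N f"
    and bound: "\<And>i j. i < N \<Longrightarrow> j < N \<Longrightarrow> cmod (\<Sum>k<N. f j k * cnj (e i k)) \<le> \<mu>"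
    and N: "3 \<le> N" and \<beta>: "1 \<le> \<beta>"
    and p: "0 \<le> p" "p \<le> 1" and q: "0 \<le> q" "q \<le> 1"
    and pN: "4 * (\<beta> + 1) * ln (real N) \<le> p * real N"
    and qN: "4 * (\<beta> + 1) * ln (real N) \<le> q * real N"
    and small: "(p * real N + q * real N) * \<mu>\<^sup>2 * (300 * (\<beta> + 1) * ln (real N)) \<le> 1"
  shows "measure_pmf.prob (pair_pmf (bernoulli_subset N p) (bernoulli_subset N q))
      {(S, T). \<exists>j<N. dependent_pair N e f S (insert j T) \<or> dependent_pair N e f (insert j S) T}
    \<le> 4 * real N powr (- \<beta>)"
proof -
  let ?P = "\<lambda>p q. measure_pmf.prob (pair_pmf (bernoulli_subset N p) (bernoulli_subset N q))"
  have bound': "cmod (\<Sum>k<N. e j k * cnj (f i k)) \<le> \<mu>" if "i < N" "j < N" for i j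
  proof -
    have "(\<Sum>k<N. e j k * cnj (f i k)) = cnj (\<Sum>k<N. f i k * cnj (e j k))"
      by (simp add: mult.commute)
    then show ?thesis using bound[OF that(2,1)] by (simp only: complex_mod_cnj)
  qed
  let ?X = "{(S, T). \<exists>j<N. dependent_pair N e f S (insert j T)}"
  let ?Y = "{(S, T). \<exists>j<N. dependent_pair N e f (insert j S) T}"
  have "?P p q ?X \<le> 2 * real N powr (- \<beta>)"
    by (rule prob_extended_dependent_pair_le[OF e f bound N \<beta> p q qN small])
  moreover have "?P p q ?Y \<le> 2 * real N powr (- \<beta>)"
  proof -
    have "?P p q ?Y = ?P q p {(T, S). \<exists>j<N. dependent_pair N f e T (insert j S)}"
      by (subst pair_commute_pmf)
        (auto simp: dependent_pair_sym[of N e f] intro!: arg_cong2[where f = measure])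
    also have "\<dots> \<le> 2 * real N powr (- \<beta>)"
      by (rule prob_extended_dependent_pair_le[OF f e bound' N \<beta> q p pN])
         (use small in \<open>auto simp: add.commute\<close>)
    finally show ?thesis .
  qed
  moreover have "?P p q (?X \<union> ?Y) \<le> ?P p q ?X + ?P p q ?Y"
    by (rule measure_Un_le) auto
  moreover have "{(S, T). \<exists>j<N. dependent_pair N e f S (insert j T) \<or> dependent_pair N e f (insert j S) T}
      = ?X \<union> ?Y" by auto
  ultimately show ?thesis by simp
qed

section \<open>Linear algebra of sparsest solutions\<close>

text \<open>Gaussian elimination: an equation with a nonzero coefficient determines one unknown, and substituting it
  leaves one equation and one unknown fewer.\<close>

lemma homogeneous_system_nontrivial_solution:
  fixes a :: "'i \<Rightarrow> 'j \<Rightarrow> 'f::field"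
  assumes "finite I" "finite J" "card I < card J"
  shows "\<exists>y. (\<exists>j\<in>J. y j \<noteq> 0) \<and> (\<forall>i\<in>I. (\<Sum>j\<in>J. a i j * y j) = 0)"
  using assms
proof (induction I arbitrary: J a rule: finite_induct)
  case empty
  then have "J \<noteq> {}" by auto
  then show ?case by (intro exI[of _ "\<lambda>_. 1"]) auto
next
  case (insert i0 I)
  show ?case
  proof (cases "\<forall>j\<in>J. a i0 j = 0")
    case True
    obtain y where "\<exists>j\<in>J. y j \<noteq> 0" "\<forall>i\<in>I. (\<Sum>j\<in>J. a i j * y j) = 0"
      using insert.IH[of J a] insert.prems insert.hyps by auto
    with True show ?thesis by (intro exI[of _ y]) simp
  next
    case False
    then obtain j0 where j0: "j0 \<in> J" "a i0 j0 \<noteq> 0" by blast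
    let ?K = "J - {j0}"
    have "card I < card ?K"
      using insert.prems insert.hyps j0 by simp
    then obtain y where nz: "\<exists>j\<in>?K. y j \<noteq> 0"
      and y: "\<And>i. i \<in> I \<Longrightarrow> (\<Sum>j\<in>?K. (a i j - a i j0 * a i0 j / a i0 j0) * y j) = 0"
      using insert.IH[of ?K "\<lambda>i j. a i j - a i j0 * a i0 j / a i0 j0"] insert.prems by auto
    \<comment> \<open>The value of the unknown \<open>j0\<close> that solves the pivot equation \<open>i0\<close>.\<close>
    define z where "z = y(j0 := - (\<Sum>j\<in>?K. a i0 j * y j) / a i0 j0)"
    have z: "(\<Sum>j\<in>J. a i j * z j) = (\<Sum>j\<in>?K. (a i j - a i j0 * a i0 j / a i0 j0) * y j)" for i
    proof -
      have "(\<Sum>j\<in>J. a i j * z j) = a i j0 * z j0 + (\<Sum>j\<in>?K. a i j * z j)"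
        using insert.prems j0 by (intro sum.remove) auto
      also have "(\<Sum>j\<in>?K. a i j * z j) = (\<Sum>j\<in>?K. a i j * y j)"
        by (intro sum.cong) (auto simp: z_def)
      also have "a i j0 * z j0 = - (\<Sum>j\<in>?K. a i j0 * a i0 j / a i0 j0 * y j)"
        by (simp add: z_def sum_distrib_left sum_divide_distrib mult_ac)
      finally show ?thesis by (simp add: left_diff_distrib sum_subtractf)
    qed
    have "(\<Sum>j\<in>J. a i0 j * z j) = 0"
      unfolding z using j0 by simp
    moreover have "\<forall>i\<in>I. (\<Sum>j\<in>J. a i j * z j) = 0"
      unfolding z using y by simp
    moreover have "\<exists>j\<in>J. z j \<noteq> 0"
      using nz by (auto simp: z_def)
    ultimately show ?thesis by (intro exI[of _ z]) simp
  qed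
qed

definition col_comb :: "complex mat \<Rightarrow> nat set \<Rightarrow> (nat \<Rightarrow> complex) \<Rightarrow> nat \<Rightarrow> complex" where
  "col_comb A T y k = (\<Sum>j\<in>T. A $$ (k, j) * y j)"

definition dependent_cols :: "complex mat \<Rightarrow> nat set \<Rightarrow> bool" where
  "dependent_cols A T \<longleftrightarrow> (\<exists>y. (\<exists>j\<in>T. y j \<noteq> 0) \<and> (\<forall>k<dim_row A. col_comb A T y k = 0))"

definition in_col_span :: "complex mat \<Rightarrow> nat set \<Rightarrow> (nat \<Rightarrow> complex) \<Rightarrow> bool" where
  "in_col_span A T v \<longleftrightarrow> (\<exists>c. \<forall>k<dim_row A. v k = col_comb A T c k)"

lemma dependent_cols_mono:
  assumes "dependent_cols A S" "S \<subseteq> T" "finite T"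
  shows "dependent_cols A T"
proof -
  obtain y where y: "\<exists>j\<in>S. y j \<noteq> 0" "\<And>k. k < dim_row A \<Longrightarrow> col_comb A S y k = 0"
    using assms(1) unfolding dependent_cols_def by blast
  let ?y = "\<lambda>j. if j \<in> S then y j else 0"
  have "col_comb A T ?y k = col_comb A S y k" for k
    unfolding col_comb_def using assms by (intro sum.mono_neutral_cong_right) auto
  then show ?thesis
    unfolding dependent_cols_def using y assms(2) by (intro exI[of _ ?y]) auto
qed

text \<open>The matrix expressing the columns in \<open>J\<close> through those in \<open>T\<close> has more columns than rows, and a vector
  in its kernel is a linear relation.\<close>

lemma dependent_cols_of_card_less:
  assumes fin: "finite T" "finite J" and card: "card T < card J"
    and span: "\<And>j. j \<in> J \<Longrightarrow> in_col_span A T (\<lambda>k. A $$ (k, j))"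
  shows "dependent_cols A J"
proof -
  from span have "\<forall>j\<in>J. \<exists>c. \<forall>k<dim_row A. A $$ (k, j) = col_comb A T c k"
    unfolding in_col_span_def by blast
  then obtain c where c: "\<And>j k. j \<in> J \<Longrightarrow> k < dim_row A \<Longrightarrow> A $$ (k, j) = col_comb A T (c j) k"
    by metis
  obtain y where y: "\<exists>j\<in>J. y j \<noteq> 0" "\<And>t. t \<in> T \<Longrightarrow> (\<Sum>j\<in>J. c j t * y j) = 0"
    using homogeneous_system_nontrivial_solution[OF fin card, of "\<lambda>t j. c j t"] by blast
  have "col_comb A J y k = 0" if k: "k < dim_row A" for k
  proof -
    have "col_comb A J y k = (\<Sum>j\<in>J. \<Sum>t\<in>T. A $$ (k, t) * (c j t * y j))"
      unfolding col_comb_def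
    proof (intro sum.cong refl)
      fix j assume "j \<in> J"
      then show "A $$ (k, j) * y j = (\<Sum>t\<in>T. A $$ (k, t) * (c j t * y j))"
        using c[OF _ k, of j] by (simp add: col_comb_def sum_distrib_right mult.assoc)
    qed
    also have "\<dots> = (\<Sum>t\<in>T. A $$ (k, t) * (\<Sum>j\<in>J. c j t * y j))"
      unfolding sum_distrib_left by (rule sum.swap)
    also have "\<dots> = 0" using y(2) by simp
    finally show ?thesis .
  qed
  with y(1) show ?thesis unfolding dependent_cols_def by blast
qed

lemma col_in_span_self:
  assumes "finite T" "t \<in> T"
  shows "in_col_span A T (\<lambda>k. A $$ (k, t))"
  unfolding in_col_span_def col_comb_def
  using assms by (intro exI[of _ "\<lambda>j. if j = t then 1 else 0"]) (simp add: if_distrib cong: if_cong)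

text \<open>Otherwise \<open>T\<close> would span too many independent columns: those of \<open>S\<close> and one more from \<open>T\<close> if
  \<open>T\<close> is not contained in \<open>S\<close>, or those of \<open>S\<close> alone if \<open>T\<close> is a proper subset.\<close>

lemma ex_col_not_in_span:
  assumes fin: "finite S" "finite T" and card: "card T \<le> card S" and ne: "T \<noteq> S"
    and S: "\<not> dependent_cols A S" and indep: "\<And>t. t \<in> T \<Longrightarrow> \<not> dependent_cols A (insert t S)"
  shows "\<exists>g\<in>S. \<not> in_col_span A T (\<lambda>k. A $$ (k, g))"
proof (rule ccontr)
  assume "\<not> ?thesis"
  then have span: "in_col_span A T (\<lambda>k. A $$ (k, g))" if "g \<in> S" for g using that by blast
  show False
  proof (cases "T \<subseteq> S")
    case True
    then have "card T < card S"
      using ne fin by (intro psubset_card_mono) auto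
    then show False
      using dependent_cols_of_card_less[OF fin(2,1)] span S by blast
  next
    case False
    then obtain t where t: "t \<in> T" "t \<notin> S" by blast
    have "dependent_cols A (insert t S)"
      by (rule dependent_cols_of_card_less[OF fin(2)])
         (use fin card t span col_in_span_self in auto)
    then show False using indep t by blast
  qed
qed

definition support_below :: "nat \<Rightarrow> (nat \<Rightarrow> complex) \<Rightarrow> nat set" where
  "support_below n x = {j \<in> {..<n}. x j \<noteq> 0}"

lemma l0_norm_vec: "l0_norm (Matrix.vec n x) = card (support_below n x)"
  unfolding l0_norm_def support_below_def by (rule arg_cong[where f = card]) auto

lemma mult_mat_vec_eq_iff:
  assumes "A \<in> carrier_mat m n"
  shows "A *\<^sub>v Matrix.vec n y = A *\<^sub>v Matrix.vec n x \<longleftrightarrow>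
    (\<forall>k<m. col_comb A {..<n} y k = col_comb A {..<n} x k)"
  using assms
  by (auto simp: vec_eq_iff scalar_prod_def col_comb_def atLeast0LessThan)

lemma col_comb_support:
  assumes "support_below n y \<subseteq> T" "T \<subseteq> {..<n}"
  shows "col_comb A {..<n} y k = col_comb A T y k"
  unfolding col_comb_def
  using assms by (intro sum.mono_neutral_right) (auto simp: support_below_def)

text \<open>A competitor supported in \<open>T\<close> differs from \<open>x\<close> automatically if \<open>T\<close> does not contain the support of
  \<open>x\<close>; otherwise it differs from \<open>x\<close> by a linear relation on \<open>T\<close>. In the second case the condition does not
  depend on the values of \<open>x\<close>, and in the first it is the complement of a subspace. This form makes the
  measurability of the event evident.\<close>

lemma P0_solutions_eq_iff:
  assumes A: "A \<in> carrier_mat m n"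
  shows "P0_solutions A (A *\<^sub>v Matrix.vec n x) = {Matrix.vec n x} \<longleftrightarrow>
    (\<forall>T\<in>Pow {..<n}. card T \<le> card (support_below n x) \<longrightarrow>
      (if support_below n x \<subseteq> T then \<not> dependent_cols A T
       else \<not> in_col_span A T (col_comb A {..<n} x)))"
  (is "?unique \<longleftrightarrow> ?cond")
proof
  let ?S = "support_below n x"
  have row: "dim_row A = m" and col: "dim_col A = n" using A by auto
  {
    assume unique: ?unique
    have no_other: "Matrix.vec n y = Matrix.vec n x"
      if "A *\<^sub>v Matrix.vec n y = A *\<^sub>v Matrix.vec n x" "card (support_below n y) \<le> card ?S" for y
    proof -
      have "Matrix.vec n x \<in> P0_solutions A (A *\<^sub>v Matrix.vec n x)" using unique by simp
      then have "Matrix.vec n y \<in> P0_solutions A (A *\<^sub>v Matrix.vec n x)"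
        using that order_trans[OF that(2)] by (auto simp: P0_solutions_def l0_norm_vec col)
      then show ?thesis using unique by simp
    qed
    show ?cond
    proof (intro ballI impI)
      fix T assume T: "T \<in> Pow {..<n}" "card T \<le> card ?S"
      have finT: "finite T" using T finite_subset by auto
      have cardT: "card (support_below n y) \<le> card ?S" if "support_below n y \<subseteq> T" for y
        using card_mono[OF finT that] T by simp
      show "if ?S \<subseteq> T then \<not> dependent_cols A T else \<not> in_col_span A T (col_comb A {..<n} x)"
      proof (cases "?S \<subseteq> T")
        case True
        have "\<not> dependent_cols A T"
        proof
          assume "dependent_cols A T"
          then obtain h j where h: "\<And>k. k < m \<Longrightarrow> col_comb A T h k = 0" and j: "j \<in> T" "h j \<noteq> 0"
            unfolding dependent_cols_def row by blast
          define y where "y = (\<lambda>j. x j + (if j \<in> T then h j else 0))"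
          have supp: "support_below n y \<subseteq> T"
            using True by (auto simp: support_below_def y_def split: if_splits)
          have "col_comb A {..<n} y k = col_comb A {..<n} x k" if "k < m" for k
          proof -
            have "col_comb A T y k = col_comb A T x k + col_comb A T h k"
              by (simp add: col_comb_def y_def distrib_left sum.distrib)
            then show ?thesis
              using h[OF that] col_comb_support[OF supp, of A k] col_comb_support[OF True, of A k] T
              by simp
          qed
          then have "Matrix.vec n y = Matrix.vec n x"
            using no_other[of y] cardT[OF supp] mult_mat_vec_eq_iff[OF A] by blast
          then have "y j = x j"
            using j T by (metis PowD index_vec lessThan_iff subsetD)
          then show False using j by (simp add: y_def)
        qed
        with True show ?thesis by simp
      next
        case False
        have "\<not> in_col_span A T (col_comb A {..<n} x)"
        proof
          assume "in_col_span A T (col_comb A {..<n} x)"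
          then obtain c where c: "\<And>k. k < m \<Longrightarrow> col_comb A {..<n} x k = col_comb A T c k"
            unfolding in_col_span_def row by blast
          define y where "y = (\<lambda>j. if j \<in> T then c j else 0)"
          have supp: "support_below n y \<subseteq> T"
            by (auto simp: support_below_def y_def split: if_splits)
          have "col_comb A {..<n} y k = col_comb A {..<n} x k" if "k < m" for k
          proof -
            have "col_comb A T y k = col_comb A T c k"
              by (simp add: col_comb_def y_def)
            then show ?thesis
              using c[OF that] col_comb_support[OF supp, of A k] T by simp
          qed
          then have eq: "Matrix.vec n y = Matrix.vec n x"
            using no_other[of y] cardT[OF supp] mult_mat_vec_eq_iff[OF A] by blast
          then have "y j = x j" if "j < n" for j
            using that by (metis index_vec)
          then have "?S \<subseteq> T"
            using supp by (auto simp: support_below_def)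
          then show False using False by simp
        qed
        with False show ?thesis by simp
      qed
    qed
  }
  {
    assume cond: ?cond
    have no_other: "b = Matrix.vec n x"
      if b: "b \<in> carrier_vec n" "A *\<^sub>v b = A *\<^sub>v Matrix.vec n x" "l0_norm b \<le> l0_norm (Matrix.vec n x)" for b
    proof -
      define y where "y j = b $ j" for j
      have b_eq: "b = Matrix.vec n y" using b by (auto simp: y_def)
      let ?T = "support_below n y"
      have T: "?T \<in> Pow {..<n}" "card ?T \<le> card ?S"
        using b(3) by (auto simp: b_eq l0_norm_vec support_below_def)
      have eq: "\<And>k. k < m \<Longrightarrow> col_comb A {..<n} y k = col_comb A {..<n} x k"
        using b(2) mult_mat_vec_eq_iff[OF A] by (auto simp: b_eq)
      have span: "in_col_span A ?T (col_comb A {..<n} x)"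
        unfolding in_col_span_def row using eq col_comb_support[of n y ?T A] T
        by (intro exI[of _ y]) auto
      then have sub: "?S \<subseteq> ?T" and indep: "\<not> dependent_cols A ?T"
        using cond T by (auto split: if_splits)
      have diff: "col_comb A ?T (\<lambda>j. y j - x j) k = 0" if "k < m" for k
        using eq[OF that] col_comb_support[of n y ?T A k] col_comb_support[OF sub, of A k] T
        by (simp add: col_comb_def right_diff_distrib sum_subtractf)
      have on_T: "y j - x j = 0" if "j \<in> ?T" for j
      proof (rule ccontr)
        assume "y j - x j \<noteq> 0"
        then have "dependent_cols A ?T"
          unfolding dependent_cols_def row using diff that
          by (intro exI[of _ "\<lambda>j. y j - x j"]) blast
        then show False using indep by simp
      qed
      have "y j = x j" if "j < n" for j
      proof (cases "j \<in> ?T")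
        case True
        then show ?thesis using on_T by simp
      next
        case False
        then show ?thesis using sub that by (auto simp: support_below_def)
      qed
      then show ?thesis by (auto simp: b_eq)
    qed
    show ?unique
    proof (intro equalityI subsetI)
      fix b assume "b \<in> P0_solutions A (A *\<^sub>v Matrix.vec n x)"
      then show "b \<in> {Matrix.vec n x}"
        using no_other[of b] by (auto simp: P0_solutions_def col)
    next
      fix b assume "b \<in> {Matrix.vec n x}"
      then show "b \<in> P0_solutions A (A *\<^sub>v Matrix.vec n x)"
        using no_other by (auto simp: P0_solutions_def col) (metis nle_le)
    qed
  }
qed

text \<open>Membership in a subspace is a measurable condition. Eliminating one spanning vector at a time turns it
  into finitely many linear equations in the \<open>g k\<close>.\<close>

lemma pred_ex_linear_combination:
  fixes g :: "'i \<Rightarrow> 'a \<Rightarrow> complex" and \<phi> :: "'i \<Rightarrow> 'j \<Rightarrow> complex"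
  assumes "finite T" and "finite I" and "\<And>k. k \<in> I \<Longrightarrow> g k \<in> borel_measurable M"
  shows "Measurable.pred M (\<lambda>x. \<exists>c. \<forall>k\<in>I. g k x = (\<Sum>t\<in>T. \<phi> k t * c t))"
  using assms(1,3)
proof (induction T arbitrary: g \<phi> rule: finite_induct)
  case empty
  note [measurable] = empty
  show ?case using assms(2) by simp
next
  case (insert t T)
  show ?case
  proof (cases "\<forall>k\<in>I. \<phi> k t = 0")
    case True
    have "(\<exists>c. \<forall>k\<in>I. g k x = (\<Sum>t\<in>insert t T. \<phi> k t * c t)) \<longleftrightarrow>
        (\<exists>c. \<forall>k\<in>I. g k x = (\<Sum>t\<in>T. \<phi> k t * c t))" for x
      using True insert.hyps by simp
    then show ?thesis using insert.IH[OF insert.prems] by simp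
  next
    case False
    then obtain k0 where k0: "k0 \<in> I" "\<phi> k0 t \<noteq> 0" by blast
    \<comment> \<open>Use the equation \<open>k0\<close> to eliminate the coefficient of \<open>t\<close> from all the equations.\<close>
    let ?r = "\<lambda>k. \<phi> k t / \<phi> k0 t"
    let ?g = "\<lambda>k x. g k x - ?r k * g k0 x" and ?\<phi> = "\<lambda>k s. \<phi> k s - ?r k * \<phi> k0 s"
    have eq: "(\<Sum>s\<in>T. ?\<phi> k s * c s) = (\<Sum>s\<in>T. \<phi> k s * c s) - ?r k * (\<Sum>s\<in>T. \<phi> k0 s * c s)" for k c
      by (simp add: left_diff_distrib sum_subtractf sum_distrib_left mult.assoc)
    have "(\<exists>c. \<forall>k\<in>I. g k x = (\<Sum>s\<in>insert t T. \<phi> k s * c s)) \<longleftrightarrow>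
        (\<exists>c. \<forall>k\<in>I. ?g k x = (\<Sum>s\<in>T. ?\<phi> k s * c s))" (is "?L \<longleftrightarrow> ?R") for x
    proof
      assume ?L
      then obtain c where c: "\<And>k. k \<in> I \<Longrightarrow> g k x = \<phi> k t * c t + (\<Sum>s\<in>T. \<phi> k s * c s)"
        using insert.hyps by auto
      have "?g k x = (\<Sum>s\<in>T. ?\<phi> k s * c s)" if "k \<in> I" for k
        unfolding eq c[OF that] c[OF k0(1)] using k0(2) by (simp add: field_simps)
      then show ?R by blast
    next
      assume ?R
      then obtain c where c: "\<And>k. k \<in> I \<Longrightarrow> ?g k x = (\<Sum>s\<in>T. \<phi> k s * c s) - ?r k * (\<Sum>s\<in>T. \<phi> k0 s * c s)"
        unfolding eq by blast
      define d where "d = c(t := (g k0 x - (\<Sum>s\<in>T. \<phi> k0 s * c s)) / \<phi> k0 t)"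
      have d: "(\<Sum>s\<in>T. \<phi> k s * d s) = (\<Sum>s\<in>T. \<phi> k s * c s)" for k
        using insert.hyps by (intro sum.cong) (auto simp: d_def)
      have dt: "\<phi> k t * d t = ?r k * g k0 x - ?r k * (\<Sum>s\<in>T. \<phi> k0 s * c s)" for k
        by (simp add: d_def right_diff_distrib diff_divide_distrib)
      have "g k x = (\<Sum>s\<in>insert t T. \<phi> k s * d s)" if "k \<in> I" for k
      proof -
        have "g k x = ?g k x + ?r k * g k0 x" by simp
        also have "\<dots> = \<phi> k t * d t + (\<Sum>s\<in>T. \<phi> k s * d s)"
          unfolding c[OF that] dt d by simp
        finally show ?thesis using insert.hyps by simp
      qed
      then show ?L by blast
    qed
    moreover have "Measurable.pred M (\<lambda>x. \<exists>c. \<forall>k\<in>I. ?g k x = (\<Sum>s\<in>T. ?\<phi> k s * c s))"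
      using insert.prems k0 by (intro insert.IH borel_measurable_diff borel_measurable_times) auto
    ultimately show ?thesis by simp
  qed
qed

section \<open>Random coefficients\<close>

lemma pred_P0_solutions_eq:
  assumes A: "A \<in> carrier_mat m n"
  shows "Measurable.pred (\<Pi>\<^sub>M k\<in>{..<n}. borel)
    (\<lambda>x. P0_solutions A (A *\<^sub>v Matrix.vec n x) = {Matrix.vec n x})"
proof -
  let ?M = "\<Pi>\<^sub>M k\<in>{..<n}. (borel :: complex measure)"
  have row: "dim_row A = m" using A by auto
  have [measurable]: "(\<lambda>x. x j) \<in> borel_measurable ?M" if "j \<in> {..<n}" for j
    using that by (rule measurable_component_singleton)
  have span: "Measurable.pred ?M (\<lambda>x. in_col_span A T (col_comb A {..<n} x))"
    if "finite T" for T
  proof -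
    have "Measurable.pred ?M (\<lambda>x. \<exists>c. \<forall>k\<in>{..<m}. col_comb A {..<n} x k = (\<Sum>t\<in>T. A $$ (k, t) * c t))"
      unfolding col_comb_def using that by (intro pred_ex_linear_combination) auto
    then show ?thesis
      unfolding in_col_span_def row col_comb_def[of A T] Ball_def lessThan_iff .
  qed
  have supp: "Measurable.pred ?M (\<lambda>x. support_below n x = S)" if "S \<in> Pow {..<n}" for S
  proof -
    have "support_below n x = S \<longleftrightarrow> (\<forall>j\<in>{..<n}. x j \<noteq> 0 \<longleftrightarrow> j \<in> S)" for x
      using that by (auto simp: support_below_def)
    then show ?thesis by simp
  qed
  have "P0_solutions A (A *\<^sub>v Matrix.vec n x) = {Matrix.vec n x} \<longleftrightarrow>
    (\<forall>S\<in>Pow {..<n}. support_below n x = S \<longrightarrow> (\<forall>T\<in>Pow {..<n}. card T \<le> card S \<longrightarrow>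
      (if S \<subseteq> T then \<not> dependent_cols A T else \<not> in_col_span A T (col_comb A {..<n} x))))" for x
    unfolding P0_solutions_eq_iff[OF A] by (auto simp: support_below_def)
  moreover have "Measurable.pred ?M (\<lambda>x. \<forall>S\<in>Pow {..<n}. support_below n x = S \<longrightarrow>
    (\<forall>T\<in>Pow {..<n}. card T \<le> card S \<longrightarrow>
      (if S \<subseteq> T then \<not> dependent_cols A T else \<not> in_col_span A T (col_comb A {..<n} x))))"
  proof (intro pred_intros_finite pred_intros_logic)
    fix S T assume S: "S \<in> Pow {..<n}" and T: "T \<in> Pow {..<n}"
    show "Measurable.pred ?M (\<lambda>x. support_below n x = S)"
      by (rule supp[OF S])
    have "finite T" using T finite_subset by auto
    from span[OF this] show "Measurable.pred ?M (\<lambda>x. if S \<subseteq> T then \<not> dependent_cols A T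
        else \<not> in_col_span A T (col_comb A {..<n} x))"
      by (cases "S \<subseteq> T") (simp_all add: pred_intros_logic)
  qed auto
  ultimately show ?thesis by simp
qed

text \<open>Along the coordinate \<open>g\<close>, two different values that both put the combination into the span of \<open>T\<close>
  would put the column \<open>g\<close> there. So every line in that direction meets the exceptional set in at most
  one point, and integrating over the coordinate \<open>g\<close> first shows that the set is null.\<close>

lemma AE_not_in_col_span:
  fixes D :: "complex measure"
  assumes D: "prob_space D" "sets D = sets borel" and no_atom: "\<And>a. emeasure D {a} = 0"
    and S: "S \<subseteq> {..<n}" and g: "g \<in> S" and T: "finite T"
    and out: "\<not> in_col_span A T (\<lambda>k. A $$ (k, g))"
  shows "AE x in (\<Pi>\<^sub>M k\<in>{..<n}. if k \<in> S then D else return borel 0).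
    \<not> in_col_span A T (col_comb A {..<n} x)"
proof -
  let ?F = "\<lambda>k. if k \<in> S then D else return borel (0 :: complex)"
  let ?M = "\<Pi>\<^sub>M k\<in>{..<n}. ?F k"
  let ?B = "\<lambda>x. in_col_span A T (col_comb A {..<n} x)"
  have prob: "prob_space (?F k)" for k
    using D by (auto intro: prob_space_return)
  interpret product_prob_space ?F
    by (rule product_prob_spaceI) (rule prob)
  have setsF: "sets (?F k) = sets borel" for k
    using D by simp
  have [measurable_cong]: "sets ?M = sets (\<Pi>\<^sub>M k\<in>{..<n}. (borel :: complex measure))"
    by (intro sets_PiM_cong refl setsF)
  have comp [measurable]: "(\<lambda>x. x j) \<in> borel_measurable ?M" if "j \<in> {..<n}" for j
    using measurable_component_singleton[OF that, of ?F] setsF by (simp cong: measurable_cong_sets)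
  have B [measurable]: "Measurable.pred ?M ?B"
  proof -
    have "Measurable.pred ?M (\<lambda>x. \<exists>c. \<forall>k\<in>{..<dim_row A}. col_comb A {..<n} x k = (\<Sum>t\<in>T. A $$ (k, t) * c t))"
      unfolding col_comb_def using T by (intro pred_ex_linear_combination) auto
    then show ?thesis
      unfolding in_col_span_def col_comb_def[of A T] Ball_def lessThan_iff .
  qed
  have gn: "g < n" using g S by auto
  \<comment> \<open>The exceptional set meets each line in direction \<open>g\<close> in at most one point.\<close>
  have line: "\<exists>a. \<forall>y. ?B (x(g := y)) \<longrightarrow> y = a" for x
  proof (rule ccontr)
    assume "\<not> ?thesis"
    then obtain y y' where yy: "?B (x(g := y))" "?B (x(g := y'))" "y \<noteq> y'" by metis
    obtain c c' where c: "\<And>k. k < dim_row A \<Longrightarrow> col_comb A {..<n} (x(g := y)) k = col_comb A T c k"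
      and c': "\<And>k. k < dim_row A \<Longrightarrow> col_comb A {..<n} (x(g := y')) k = col_comb A T c' k"
      using yy unfolding in_col_span_def by blast
    have upd: "col_comb A {..<n} (x(g := z)) k = A $$ (k, g) * z + (\<Sum>j\<in>{..<n} - {g}. A $$ (k, j) * x j)" for z k
      unfolding col_comb_def using gn by (subst sum.remove[of _ g]) (auto intro!: sum.cong)
    have "A $$ (k, g) = col_comb A T (\<lambda>t. (c t - c' t) / (y - y')) k" if "k < dim_row A" for k
    proof -
      have "A $$ (k, g) * (y - y') = col_comb A T c k - col_comb A T c' k"
        unfolding c[OF that, symmetric] c'[OF that, symmetric] upd by (simp add: algebra_simps)
      also have "\<dots> = (\<Sum>t\<in>T. A $$ (k, t) * (c t - c' t))"
        by (simp add: col_comb_def right_diff_distrib sum_subtractf)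
      finally have "A $$ (k, g) = (\<Sum>t\<in>T. A $$ (k, t) * (c t - c' t)) / (y - y')"
        using yy(3) by (simp add: field_simps)
      then show ?thesis by (simp add: col_comb_def sum_divide_distrib)
    qed
    then show False using out unfolding in_col_span_def by blast
  qed
  have "emeasure ?M {x \<in> space ?M. ?B x} = (\<integral>\<^sup>+x. indicator {x \<in> space ?M. ?B x} x \<partial>?M)"
    by simp
  also have "\<dots> = (\<integral>\<^sup>+x. of_bool (?B x) \<partial>?M)"
    by (intro nn_integral_cong) (auto simp: indicator_def)
  also have "\<dots> = (\<integral>\<^sup>+x. \<integral>\<^sup>+y. of_bool (?B (x(g := y))) \<partial>?F g \<partial>(\<Pi>\<^sub>M k\<in>{..<n} - {g}. ?F k))"
  proof -
    have ins: "insert g ({..<n} - {g}) = {..<n}" using gn by auto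
    have "(\<lambda>x. of_bool (?B x) :: ennreal) \<in> borel_measurable ?M" by measurable
    then show ?thesis
      by (intro product_nn_integral_insert[of "{..<n} - {g}" g "\<lambda>x. of_bool (?B x)", unfolded ins])
         simp_all
  qed
  also have "\<dots> = (\<integral>\<^sup>+x. 0 \<partial>(\<Pi>\<^sub>M k\<in>{..<n} - {g}. ?F k))"
  proof (intro nn_integral_cong)
    fix x
    obtain a where a: "\<And>y. ?B (x(g := y)) \<Longrightarrow> y = a" using line by blast
    have "(\<integral>\<^sup>+y. of_bool (?B (x(g := y))) \<partial>?F g) \<le> (\<integral>\<^sup>+y. indicator {a} y \<partial>?F g)"
      using a by (intro nn_integral_mono) (auto simp: indicator_def)
    also have "\<dots> = 0"
      using g no_atom D by simp
    finally show "(\<integral>\<^sup>+y. of_bool (?B (x(g := y))) \<partial>?F g) = 0" by simp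
  qed
  finally have "emeasure ?M {x \<in> space ?M. ?B x} = 0" by simp
  then show ?thesis
    by (intro AE_I[of _ _ "{x \<in> space ?M. ?B x}"]) auto
qed

lemma AE_P0_solutions_eq:
  fixes D :: "complex measure"
  assumes A: "A \<in> carrier_mat m n" and n: "0 < n"
    and D: "prob_space D" "sets D = sets borel" and no_atom: "\<And>a. emeasure D {a} = 0"
    and S: "S \<subseteq> {..<n}" and indep: "\<And>j. j < n \<Longrightarrow> \<not> dependent_cols A (insert j S)"
  shows "AE x in (\<Pi>\<^sub>M k\<in>{..<n}. if k \<in> S then D else return borel 0).
    P0_solutions A (A *\<^sub>v Matrix.vec n x) = {Matrix.vec n x}"
proof -
  let ?F = "\<lambda>k. if k \<in> S then D else return borel (0 :: complex)"
  let ?M = "\<Pi>\<^sub>M k\<in>{..<n}. ?F k"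
  have prob: "prob_space (?F k)" for k
    using D by (auto intro: prob_space_return)
  have finS: "finite S" using S finite_subset by blast
  have indepS: "\<not> dependent_cols A S"
    using dependent_cols_mono[of A S "insert 0 S"] indep[OF n] finS by auto
  have "AE x in ?M. \<forall>j\<in>{..<n}. x j \<noteq> 0 \<longleftrightarrow> j \<in> S"
  proof (rule AE_finite_allI)
    fix j assume j: "j \<in> {..<n}"
    have "AE z in ?F j. z \<noteq> 0 \<longleftrightarrow> j \<in> S"
    proof (cases "j \<in> S")
      case True
      have "AE z in D. z \<noteq> 0"
        using no_atom[of 0] D by (intro AE_I[of _ _ "{0}"]) auto
      then show ?thesis using True by simp
    next
      case False
      have "AE z in return borel (0 :: complex). z = 0"
        by (subst AE_return) auto
      then show ?thesis using False by simp
    qed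
    then show "AE x in ?M. x j \<noteq> 0 \<longleftrightarrow> j \<in> S"
      by (rule AE_PiM_component[OF prob j])
  qed simp
  moreover have "AE x in ?M. \<forall>T\<in>{T \<in> Pow {..<n}. card T \<le> card S \<and> T \<noteq> S}.
      \<not> in_col_span A T (col_comb A {..<n} x)"
  proof (rule AE_finite_allI)
    fix T assume "T \<in> {T \<in> Pow {..<n}. card T \<le> card S \<and> T \<noteq> S}"
    then have T: "T \<subseteq> {..<n}" "card T \<le> card S" "T \<noteq> S" by auto
    have finT: "finite T" using T finite_subset by blast
    obtain g where "g \<in> S" "\<not> in_col_span A T (\<lambda>k. A $$ (k, g))"
      using ex_col_not_in_span[OF finS finT T(2,3) indepS] indep T(1) by blast
    then show "AE x in ?M. \<not> in_col_span A T (col_comb A {..<n} x)"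
      by (intro AE_not_in_col_span[OF D no_atom S _ finT])
  qed simp
  ultimately show ?thesis
  proof eventually_elim
    case (elim x)
    have supp: "support_below n x = S"
      using elim(1) S by (auto simp: support_below_def)
    show ?case
      unfolding P0_solutions_eq_iff[OF A] supp
    proof (intro ballI impI)
      fix T assume T: "T \<in> Pow {..<n}" "card T \<le> card S"
      have "T = S" if "S \<subseteq> T"
        using card_seteq[of T S] that T finite_subset[of T "{..<n}"] by auto
      then show "if S \<subseteq> T then \<not> dependent_cols A T else \<not> in_col_span A T (col_comb A {..<n} x)"
        using elim(2) T indepS by auto
    qed
  qed
qed

lemma continuous_distribution_no_atom:
  assumes "continuous_distribution D"
  shows "prob_space D" "sets D = sets borel" "emeasure D {a} = 0"
proof -
  obtain g where g: "g \<in> borel_measurable lborel" "D = density lborel g" and p: "prob_space D"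
    using assms unfolding continuous_distribution_def by blast
  show "prob_space D" by (rule p)
  show "sets D = sets borel" by (simp add: g)
  have "AE z in lborel. g z * indicator {a} z = 0"
    using AE_lborel_singleton[of a] by eventually_elim simp
  then have "(\<integral>\<^sup>+z. g z * indicator {a} z \<partial>lborel) = (\<integral>\<^sup>+z. 0 \<partial>(lborel :: complex measure))"
    by (rule nn_integral_cong_AE)
  then show "emeasure D {a} = 0"
    using g by (simp add: emeasure_density)
qed

lemma orthonormal_basisD:
  assumes "orthonormal_basis N B"
  shows "length B = N" and "orthonormal_rows N (\<lambda>i k. B ! i $ k)"
    and "\<And>i. i < N \<Longrightarrow> dim_vec (B ! i) = N"
proof -
  show len: "length B = N" using assms by (simp add: orthonormal_basis_def)
  have "set B \<subseteq> carrier (module_vec TYPE(complex) N)"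
    using assms unfolding orthonormal_basis_def vectorspace.basis_def[OF vec_vs] by blast
  then have "set B \<subseteq> carrier_vec N" by (simp add: module_vec_def)
  then show dim: "dim_vec (B ! i) = N" if "i < N" for i
    using nth_mem[of i B] that len carrier_vecD by blast
  show "orthonormal_rows N (\<lambda>i k. B ! i $ k)"
    using assms dim by (auto simp: orthonormal_basis_def orthonormal_rows_def scalar_prod_def atLeast0LessThan)
qed

lemma cross_gram_le_mutual_incoherence:
  assumes "orthonormal_basis N B1" "orthonormal_basis N B2" "i < N" "j < N"
  shows "cmod (\<Sum>k<N. B2 ! j $ k * cnj (B1 ! i $ k)) \<le> mutual_incoherence B1 B2"
proof -
  have "cnj (\<Sum>k<N. B2 ! j $ k * cnj (B1 ! i $ k)) = B1 ! i \<bullet>c B2 ! j"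
    using orthonormal_basisD(3)[OF assms(1,3)] orthonormal_basisD(3)[OF assms(2,4)]
    by (simp add: scalar_prod_def atLeast0LessThan mult.commute)
  then have "cmod (\<Sum>k<N. B2 ! j $ k * cnj (B1 ! i $ k)) = cmod (B1 ! i \<bullet>c B2 ! j)"
    by (metis complex_mod_cnj)
  also have "\<dots> \<le> mutual_incoherence B1 B2"
    unfolding mutual_incoherence_def
    using assms orthonormal_basisD(1)[OF assms(1)] orthonormal_basisD(1)[OF assms(2)]
    by (intro Max_ge) (auto intro!: image_eqI[of _ _ "(B1 ! i, B2 ! j)"])
  finally show ?thesis .
qed

lemma dependent_cols_dictionary:
  assumes B: "orthonormal_basis N B1" "orthonormal_basis N B2"
    and GH: "G \<subseteq> {..<N}" "H \<subseteq> {..<N}"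
    and dep: "dependent_cols (dictionary N B1 B2) (G \<union> (\<lambda>j. N + j) ` H)"
  shows "dependent_pair N (\<lambda>i k. B1 ! i $ k) (\<lambda>j k. B2 ! j $ k) G H"
proof -
  let ?\<Phi> = "dictionary N B1 B2"
  note len = orthonormal_basisD(1)[OF B(1)] orthonormal_basisD(1)[OF B(2)]
  have fin: "finite G" "finite H" using GH finite_subset by blast+
  have entry: "?\<Phi> $$ (k, i) = B1 ! i $ k" "?\<Phi> $$ (k, N + i) = B2 ! i $ k" if "k < N" "i < N" for k i
    using that len by (auto simp: dictionary_def mat_of_cols_index nth_append)
  have row: "dim_row ?\<Phi> = N" by (simp add: dictionary_def)
  obtain y where nz: "\<exists>j\<in>G \<union> (\<lambda>j. N + j) ` H. y j \<noteq> 0"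
    and y: "\<And>k. k < N \<Longrightarrow> col_comb ?\<Phi> (G \<union> (\<lambda>j. N + j) ` H) y k = 0"
    using dep unfolding dependent_cols_def row by blast
  have "(\<Sum>i\<in>G. y i * B1 ! i $ k) + (\<Sum>j\<in>H. y (N + j) * B2 ! j $ k) = 0" if k: "k < N" for k
  proof -
    have "col_comb ?\<Phi> (G \<union> (\<lambda>j. N + j) ` H) y k =
        (\<Sum>i\<in>G. ?\<Phi> $$ (k, i) * y i) + (\<Sum>j\<in>(\<lambda>j. N + j) ` H. ?\<Phi> $$ (k, j) * y j)"
      unfolding col_comb_def using fin GH by (intro sum.union_disjoint) auto
    also have "(\<Sum>j\<in>(\<lambda>j. N + j) ` H. ?\<Phi> $$ (k, j) * y j) = (\<Sum>j\<in>H. ?\<Phi> $$ (k, N + j) * y (N + j))"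
      by (subst sum.reindex) (auto simp: inj_on_def)
    also have "(\<Sum>i\<in>G. ?\<Phi> $$ (k, i) * y i) = (\<Sum>i\<in>G. y i * B1 ! i $ k)"
      using GH entry(1)[OF k] by (intro sum.cong) auto
    also have "(\<Sum>j\<in>H. ?\<Phi> $$ (k, N + j) * y (N + j)) = (\<Sum>j\<in>H. y (N + j) * B2 ! j $ k)"
      using GH entry(2)[OF k] by (intro sum.cong) auto
    finally show ?thesis using y[OF k] by simp
  qed
  then show ?thesis
    unfolding dependent_pair_def using nz by (intro exI[of _ y] exI[of _ "\<lambda>j. y (N + j)"]) auto
qed

definition extendable_support :: "complex mat \<Rightarrow> nat \<Rightarrow> nat set \<Rightarrow> bool" where
  "extendable_support A n S \<longleftrightarrow> S \<subseteq> {..<n} \<and> (\<forall>j<n. \<not> dependent_cols A (insert j S))"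

text \<open>A column index below \<open>N\<close> extends the part of the support in the first basis, any other index the part
  in the second.\<close>

lemma prob_not_extendable_support_le:
  fixes \<beta> p1 p2 :: real
  assumes B: "orthonormal_basis N B1" "orthonormal_basis N B2"
    and N: "3 \<le> N" and \<beta>: "1 \<le> \<beta>"
    and p1: "0 \<le> p1" "p1 \<le> 1" and p2: "0 \<le> p2" "p2 \<le> 1"
    and p1N: "4 * (\<beta> + 1) * ln (real N) \<le> p1 * real N"
    and p2N: "4 * (\<beta> + 1) * ln (real N) \<le> p2 * real N"
    and small: "(p1 * real N + p2 * real N) * (mutual_incoherence B1 B2)\<^sup>2 * (300 * (\<beta> + 1) * ln (real N)) \<le> 1"
  shows "measure_pmf.prob (support_pmf N p1 p2) {S. \<not> extendable_support (dictionary N B1 B2) (2 * N) S}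
    \<le> 4 * real N powr (- \<beta>)"
proof -
  let ?\<Phi> = "dictionary N B1 B2"
  let ?e = "\<lambda>i k. B1 ! i $ k" and ?f = "\<lambda>j k. B2 ! j $ k"
  let ?Q = "pair_pmf (bernoulli_subset N p1) (bernoulli_subset N p2)"
  have "measure_pmf.prob (support_pmf N p1 p2) {S. \<not> extendable_support ?\<Phi> (2 * N) S} =
      measure_pmf.prob ?Q {(S, T). \<not> extendable_support ?\<Phi> (2 * N) (S \<union> (\<lambda>j. N + j) ` T)}"
    unfolding support_pmf_def measure_map_pmf by (rule arg_cong[where f = "measure_pmf.prob ?Q"]) auto
  also have "\<dots> \<le> measure_pmf.prob ?Q
      {(S, T). \<exists>j<N. dependent_pair N ?e ?f S (insert j T) \<or> dependent_pair N ?e ?f (insert j S) T}"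
  proof (rule measure_pmf.finite_measure_mono_AE)
    have "\<exists>j<N. dependent_pair N ?e ?f S (insert j T) \<or> dependent_pair N ?e ?f (insert j S) T"
      if S: "S \<subseteq> {..<N}" and T: "T \<subseteq> {..<N}"
        and not: "\<not> extendable_support ?\<Phi> (2 * N) (S \<union> (\<lambda>j. N + j) ` T)" for S T
    proof -
      have "S \<union> (\<lambda>j. N + j) ` T \<subseteq> {..<2 * N}" using S T by fastforce
      then obtain j where j: "j < 2 * N" "dependent_cols ?\<Phi> (insert j (S \<union> (\<lambda>j. N + j) ` T))"
        using not unfolding extendable_support_def by blast
      show ?thesis
      proof (cases "j < N")
        case True
        then have "dependent_pair N ?e ?f (insert j S) T"
          using j S T by (intro dependent_cols_dictionary[OF B]) auto
        then show ?thesis using True by blast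
      next
        case False
        define i where "i = j - N"
        have i: "i < N" "j = N + i" using False j by (auto simp: i_def)
        have "dependent_pair N ?e ?f S (insert i T)"
          using j S T i by (intro dependent_cols_dictionary[OF B]) auto
        then show ?thesis using i by blast
      qed
    qed
    then show "AE z in ?Q. z \<in> {(S, T). \<not> extendable_support ?\<Phi> (2 * N) (S \<union> (\<lambda>j. N + j) ` T)} \<longrightarrow>
        z \<in> {(S, T). \<exists>j<N. dependent_pair N ?e ?f S (insert j T) \<or> dependent_pair N ?e ?f (insert j S) T}"
      by (auto simp: AE_measure_pmf_iff dest!: set_bernoulli_subset)
  qed simp
  also have "\<dots> \<le> 4 * real N powr (- \<beta>)"
    by (rule prob_extended_dependent_pair_either_le[OF orthonormal_basisD(2)[OF B(1)]
          orthonormal_basisD(2)[OF B(2)] cross_gram_le_mutual_incoherence[OF B] N \<beta> p1 p2 p1N p2N small])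
  finally show ?thesis .
qed

text \<open>The coefficient law is a mixture over the supports, and every good support contributes its full weight.\<close>

lemma measure_coeff_law_ge:
  assumes D: "continuous_distribution D"
    and E: "{x \<in> space (coeff_law N p1 p2 D). Q x} \<in> sets (coeff_law N p1 p2 D)"
    and ae: "\<And>S. ok S \<Longrightarrow> AE x in coeff_given_support N D S. Q x"
  shows "1 - measure_pmf.prob (support_pmf N p1 p2) {S. \<not> ok S}
    \<le> measure (coeff_law N p1 p2 D) {x \<in> space (coeff_law N p1 p2 D). Q x}"
proof -
  let ?P = "support_pmf N p1 p2"
  let ?E = "{x \<in> space (coeff_law N p1 p2 D). Q x}"
  interpret L: prob_space "coeff_law N p1 p2 D" by (rule prob_space_coeff_law[OF D])
  have space: "space (coeff_law N p1 p2 D) = space (coeff_given_support N D S)" for S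
    by (intro sets_eq_imp_space_eq) (simp add: sets_coeff_law[OF D] sets_coeff_given_support[OF D])
  have full: "emeasure (coeff_given_support N D S) ?E = 1" if "ok S" for S
  proof -
    interpret prob_space "coeff_given_support N D S" by (rule prob_space_coeff_given_support[OF D])
    have "?E \<in> sets (coeff_given_support N D S)"
      using E by (simp add: sets_coeff_law[OF D] sets_coeff_given_support[OF D])
    moreover have "AE x in coeff_given_support N D S. x \<in> ?E"
      using ae[OF that] AE_space by eventually_elim (simp add: space[of S])
    ultimately show ?thesis
      by (rule emeasure_eq_1_AE)
  qed
  have "ennreal (measure_pmf.prob ?P {S. ok S}) = (\<integral>\<^sup>+S. indicator {S. ok S} S \<partial>measure_pmf ?P)"
    by (simp add: measure_pmf.emeasure_eq_measure)
  also have "\<dots> \<le> (\<integral>\<^sup>+S. emeasure (coeff_given_support N D S) ?E \<partial>measure_pmf ?P)"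
    using full by (intro nn_integral_mono) (auto simp: indicator_def)
  also have "\<dots> = emeasure (coeff_law N p1 p2 D) ?E"
    using E by (subst emeasure_coeff_law[OF D]) (auto simp: sets_coeff_law[OF D])
  finally have "measure_pmf.prob ?P {S. ok S} \<le> measure (coeff_law N p1 p2 D) ?E"
    by (simp add: L.emeasure_eq_measure)
  moreover have "measure_pmf.prob ?P {S. \<not> ok S} = 1 - measure_pmf.prob ?P {S. ok S}"
    using measure_pmf.prob_compl[of "{S. ok S}" ?P] by (simp add: Compl_eq_Diff_UNIV[symmetric] Collect_neg_eq)
  ultimately show ?thesis by simp
qed

theorem theorem5p2:
  shows "\<exists>C2::real. C2 > 0 \<and> (\<forall>\<beta>::real. \<beta> \<ge> 1 \<longrightarrow> (\<exists>C::real. C > 0 \<and>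
    (\<forall>(N::nat) (B1::complex Matrix.vec list) (B2::complex Matrix.vec list)
        (p1::real) (p2::real) (D::complex measure).
      N \<ge> 512 \<longrightarrow>
      orthonormal_basis N B1 \<longrightarrow> orthonormal_basis N B2 \<longrightarrow>
      mutual_incoherence B1 B2 \<le> 1 / sqrt (2 * (\<beta> + 1) * ln (real N)) \<longrightarrow>
      0 \<le> p1 \<longrightarrow> p1 \<le> 1 \<longrightarrow> 0 \<le> p2 \<longrightarrow> p2 \<le> 1 \<longrightarrow>
      min (expected_card N p1) (expected_card N p2) \<ge> 4 * (\<beta> + 1) * ln (real N) \<longrightarrow>
      expected_card N p1 + expected_card N p2
        \<le> C2 / ((mutual_incoherence B1 B2)\<^sup>2 * ((\<beta> + 1) * ln (real N)) powr (5 / 2)) \<longrightarrow>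
      continuous_distribution D \<longrightarrow> circularly_symmetric D \<longrightarrow>
      measure (coeff_law N p1 p2 D)
        {x \<in> space (coeff_law N p1 p2 D).
          let \<Phi> = dictionary N B1 B2; \<alpha> = Matrix.vec (2 * N) x; f = \<Phi> *\<^sub>v \<alpha>
          in P0_solutions \<Phi> f = {\<alpha>}}
        \<ge> 1 - C * ln (real N) * real N powr (- \<beta>))))"
proof (rule exI[of _ "1 / 300 :: real"], rule conjI, simp, intro allI impI,
    rule exI[of _ "4 :: real"], rule conjI, simp, intro allI impI)
  fix \<beta> p1 p2 :: real and N :: nat and B1 B2 :: "complex Matrix.vec list" and D :: "complex measure"
  assume \<beta>: "\<beta> \<ge> 1" and N: "N \<ge> 512"
    and B: "orthonormal_basis N B1" "orthonormal_basis N B2"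
    and p1: "0 \<le> p1" "p1 \<le> 1" and p2: "0 \<le> p2" "p2 \<le> 1"
    and large: "min (expected_card N p1) (expected_card N p2) \<ge> 4 * (\<beta> + 1) * ln (real N)"
    and small: "expected_card N p1 + expected_card N p2
      \<le> 1 / 300 / ((mutual_incoherence B1 B2)\<^sup>2 * ((\<beta> + 1) * ln (real N)) powr (5 / 2))"
    and D: "continuous_distribution D"
  let ?\<Phi> = "dictionary N B1 B2" and ?\<mu> = "mutual_incoherence B1 B2"
  define L where "L = (\<beta> + 1) * ln (real N)"
  have lnN: "1 \<le> ln (real N)"
  proof -
    have "exp 1 \<le> real N" using exp_le N by linarith
    then show ?thesis using N by (subst ln_ge_iff) auto
  qed
  have L1: "2 \<le> L"
    unfolding L_def using lnN \<beta> mult_mono[of 2 "\<beta> + 1" 1 "ln (real N)"] by simp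
  have pN: "4 * (\<beta> + 1) * ln (real N) \<le> p1 * real N" "4 * (\<beta> + 1) * ln (real N) \<le> p2 * real N"
    using large by (simp_all add: expected_card_eq p1 p2)
  define E where "E = p1 * real N + p2 * real N"
  have E: "0 < E" "E \<le> 1 / 300 / (?\<mu>\<^sup>2 * L powr (5 / 2))"
  proof -
    have "4 * L \<le> p1 * real N" using pN(1) unfolding L_def mult.assoc .
    moreover have "0 \<le> p2 * real N" using p2 by simp
    ultimately show "0 < E" using L1 unfolding E_def by linarith
    show "E \<le> 1 / 300 / (?\<mu>\<^sup>2 * L powr (5 / 2))"
      using small unfolding expected_card_eq[OF p1] expected_card_eq[OF p2] E_def L_def .
  qed
  \<comment> \<open>With \<open>\<mu> = 0\<close> the right-hand side of the sparsity bound would be a division by zero, hence 0, while \<open>E > 0\<close>.\<close>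
  have "0 < ?\<mu>\<^sup>2 * L powr (5 / 2)"
  proof -
    have "?\<mu>\<^sup>2 * L powr (5 / 2) \<noteq> 0" using E by auto
    then show ?thesis by (simp add: less_le)
  qed
  then have "E * (?\<mu>\<^sup>2 * L powr (5 / 2)) \<le> 1 / 300"
    using E(2) by (simp only: pos_le_divide_eq)
  moreover have "E * (?\<mu>\<^sup>2 * L) \<le> E * (?\<mu>\<^sup>2 * L powr (5 / 2))"
    using powr_mono[of 1 "5 / 2" L] L1 E by (intro mult_left_mono) auto
  ultimately have density: "(p1 * real N + p2 * real N) * ?\<mu>\<^sup>2 * (300 * (\<beta> + 1) * ln (real N)) \<le> 1"
    by (simp add: E_def L_def algebra_simps)
  have bad: "measure_pmf.prob (support_pmf N p1 p2) {S. \<not> extendable_support ?\<Phi> (2 * N) S}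
      \<le> 4 * real N powr (- \<beta>)"
    by (rule prob_not_extendable_support_le[OF B _ \<beta> p1 p2 pN density]) (use N in simp)
  have carrier: "?\<Phi> \<in> carrier_mat N (2 * N)"
    using orthonormal_basisD(1)[OF B(1)] orthonormal_basisD(1)[OF B(2)] by (auto simp: dictionary_def)
  let ?Q = "\<lambda>x. P0_solutions ?\<Phi> (?\<Phi> *\<^sub>v Matrix.vec (2 * N) x) = {Matrix.vec (2 * N) x}"
  have "1 - 4 * ln (real N) * real N powr (- \<beta>) \<le> 1 - 4 * real N powr (- \<beta>)"
    using lnN mult_right_mono[of 1 "ln (real N)" "4 * real N powr (- \<beta>)"] by simp
  also have "\<dots> \<le> 1 - measure_pmf.prob (support_pmf N p1 p2) {S. \<not> extendable_support ?\<Phi> (2 * N) S}"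
    using bad by simp
  also have "\<dots> \<le> measure (coeff_law N p1 p2 D) {x \<in> space (coeff_law N p1 p2 D). ?Q x}"
  proof (rule measure_coeff_law_ge[OF D])
    have "{x \<in> space (\<Pi>\<^sub>M k\<in>{..<2 * N}. borel). ?Q x} \<in> sets (\<Pi>\<^sub>M k\<in>{..<2 * N}. borel)"
      using pred_P0_solutions_eq[OF carrier] by (simp add: pred_def)
    then show "{x \<in> space (coeff_law N p1 p2 D). ?Q x} \<in> sets (coeff_law N p1 p2 D)"
      using sets_eq_imp_space_eq[OF sets_coeff_law[OF D, of N p1 p2]] by (simp add: sets_coeff_law[OF D])
    show "AE x in coeff_given_support N D S. ?Q x" if "extendable_support ?\<Phi> (2 * N) S" for S
      unfolding coeff_given_support_def
      using that N
      by (intro AE_P0_solutions_eq[OF carrier _ continuous_distribution_no_atom[OF D]])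
         (auto simp: extendable_support_def)
  qed
  finally show "measure (coeff_law N p1 p2 D)
        {x \<in> space (coeff_law N p1 p2 D).
          let \<Phi> = dictionary N B1 B2; \<alpha> = Matrix.vec (2 * N) x; f = \<Phi> *\<^sub>v \<alpha>
          in P0_solutions \<Phi> f = {\<alpha>}}
        \<ge> 1 - 4 * ln (real N) * real N powr (- \<beta>)"
    by (simp add: Let_def)
qed

end
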